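(* Let $\mathcal C$ and $\mathcal D$ be graph classes such that $\mathcal C$ transduces $\mathcal D$. If $\mathcal C$ has bounded merge-width, then $\mathcal D$ has bounded merge-width.
   Context: Graphs are finite, simple and undirected: $G=(V,E(G))$ with $E(G)\subseteq\binom V2$. Transductions. A graph class $\mathcal C$ transduces a graph class $\mathcal D$ if there is a first-order formula $\varphi(x,y)$ using the binary edge relation symbol and (finitely many) additional unary relation symbols, such that every $H\in\mathcal D$ can be obtained from some $G\in\mathcal C$ as follows: (1) expand $G$ arbitrarily by the unary relations appearing in $\varphi$, obtaining a structure $G'$; (2) pick an arbitrary subset $W\subseteq V(G)$; (3) let $H$ be the graph with vertex set $W$ and edges $\{u,v\}\in\binom W2$ such that $G'\models\varphi(u,v)\lor\varphi(v,u)$. Merge-width. A construction sequence on $V$ is a sequence of steps maintaining a partition $\mathcal P$ of $V$ and a partition of $\binom V2$ into edges $E$, non-edges $N$, and unresolved pairs $U$. Initially $\mathcal P$ is the partition into singletons and $U=\binom V2$. In each step one of three operations is performed: merge two parts $A,B\in\mathcal P$, replacing them by $A\cup B$; resolve positively a pair of parts $A,B\in\mathcal P$ (possibly $A=B$), moving all $\{a,b\}\in U$ with $a\in A,b\in B$ from $U$ to $E$; or resolve negatively such a pair of parts, moving these pairs from $U$ to $N$. In the end $\mathcal P$ has one part and $U=\emptyset$; it is then a construction sequence of the graph $(V,E)$. Its radius-$r$ width is the least $k$ such that at every step, for every $v\in V$, at most $k$ parts of the current $\mathcal P$ contain a vertex reachable from $v$ by a path of length at most $r$ in the graph $(V,E\cup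 N)$ for the current $E,N$. The radius-$r$ merge-width $\mathrm{mw}_r(G)$ is the least radius-$r$ width of a construction sequence of $G$. A graph class $\mathcal C$ has bounded merge-width if $\sup_{G\in\mathcal C}\mathrm{mw}_r(G)<\infty$ for every $r\in\mathbb N$. *)

theory Defs
  imports "HOL-Library.Ramsey" "HOL-Library.Extended_Nat"
begin

text \<open>
  The set of two-element subsets of \<open>V\<close> is \<open>nsets V 2\<close>.
\<close>

record 'a ugraph =
  verts :: "'a set"
  edges :: "'a set set"

definition finite_simple_graph :: "'a ugraph \<Rightarrow> bool" where
  "finite_simple_graph G \<longleftrightarrow> finite (verts G) \<and> edges G \<subseteq> nsets (verts G) 2"

definition graph_class :: "'a ugraph set \<Rightarrow> bool" where
  "graph_class \<C> \<longleftrightarrow> (\<forall>G\<in>\<C>. finite_simple_graph G)"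

definition isomorphic :: "'a ugraph \<Rightarrow> 'b ugraph \<Rightarrow> bool" where
  "isomorphic G H \<longleftrightarrow>
     (\<exists>f. bij_betw f (verts G) (verts H) \<and> edges H = (\<lambda>e. f ` e) ` edges G)"

definition path :: "'a ugraph \<Rightarrow> 'a list \<Rightarrow> bool" where
  "path G p \<longleftrightarrow> p \<noteq> [] \<and> set p \<subseteq> verts G \<and> distinct p \<and>
     successively (\<lambda>u w. {u, w} \<in> edges G) p"

text \<open>The length of a path is its number of edges.\<close>

definition reachable_within :: "'a ugraph \<Rightarrow> nat \<Rightarrow> 'a \<Rightarrow> 'a \<Rightarrow> bool" where
  "reachable_within G r v w \<longleftrightarrow>
     (\<exists>p. path G p \<and> hd p = v \<and> last p = w \<and> length p - 1 \<le> r)"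

text \<open>
  Formulas over one binary edge symbol and unary symbols \<open>P\<^sub>0, P\<^sub>1, \<dots>\<close>, of which each formula
  uses only finitely many; the other connectives and the universal quantifier are definable.
  Variables are natural numbers, and \<open>Col i z\<close> is the atom \<open>P\<^sub>i(z)\<close>.
\<close>

datatype fo =
    Eq nat nat
  | Adj nat nat
  | Col nat nat
  | Neg fo
  | Conj fo fo
  | Ex nat fo

fun free_vars :: "fo \<Rightarrow> nat set" where
  "free_vars (Eq x y) = {x, y}"
| "free_vars (Adj x y) = {x, y}"
| "free_vars (Col i x) = {x}"
| "free_vars (Neg \<phi>) = free_vars \<phi>"
| "free_vars (Conj \<phi> \<psi>) = free_vars \<phi> \<union> free_vars \<psi>"
| "free_vars (Ex x \<phi>) = free_vars \<phi> - {x}"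

fun sat :: "'a ugraph \<Rightarrow> (nat \<Rightarrow> 'a set) \<Rightarrow> (nat \<Rightarrow> 'a) \<Rightarrow> fo \<Rightarrow> bool" where
  "sat G P \<sigma> (Eq x y) \<longleftrightarrow> \<sigma> x = \<sigma> y"
| "sat G P \<sigma> (Adj x y) \<longleftrightarrow> {\<sigma> x, \<sigma> y} \<in> edges G"
| "sat G P \<sigma> (Col i x) \<longleftrightarrow> \<sigma> x \<in> P i"
| "sat G P \<sigma> (Neg \<phi>) \<longleftrightarrow> \<not> sat G P \<sigma> \<phi>"
| "sat G P \<sigma> (Conj \<phi> \<psi>) \<longleftrightarrow> sat G P \<sigma> \<phi> \<and> sat G P \<sigma> \<psi>"
| "sat G P \<sigma> (Ex x \<phi>) \<longleftrightarrow> (\<exists>a\<in>verts G. sat G P (\<sigma>(x := a)) \<phi>)"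

text \<open>
  For a formula with free variables among \<open>0\<close> and \<open>1\<close>, standing for \<open>x\<close> and \<open>y\<close>;
  the value given to the other variables is then irrelevant.
\<close>

definition sat2 :: "'a ugraph \<Rightarrow> (nat \<Rightarrow> 'a set) \<Rightarrow> fo \<Rightarrow> 'a \<Rightarrow> 'a \<Rightarrow> bool" where
  "sat2 G P \<phi> u v \<longleftrightarrow> sat G P ((\<lambda>_. undefined)(0 := u, 1 := v)) \<phi>"

definition transduced_graph :: "fo \<Rightarrow> 'a ugraph \<Rightarrow> (nat \<Rightarrow> 'a set) \<Rightarrow> 'a set \<Rightarrow> 'a ugraph" where
  "transduced_graph \<phi> G P W =
     \<lparr>verts = W,
      edges = {{u, v} | u v. u \<in> W \<and> v \<in> W \<and> u \<noteq> v \<and> (sat2 G P \<phi> u v \<or> sat2 G P \<phi> v u)}\<rparr>"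

text \<open>
  Graphs are identified up to isomorphism, so that the vertices of the two classes may have
  different types.
\<close>

definition transduces :: "'a ugraph set \<Rightarrow> 'b ugraph set \<Rightarrow> bool" where
  "transduces \<C> \<D> \<longleftrightarrow>
     (\<exists>\<phi>. free_vars \<phi> \<subseteq> {0, 1} \<and>
       (\<forall>H\<in>\<D>. \<exists>G\<in>\<C>. \<exists>P W. (\<forall>i. P i \<subseteq> verts G) \<and> W \<subseteq> verts G \<and>
          isomorphic (transduced_graph \<phi> G P W) H))"

record 'a cstate =
  parts :: "'a set set"
  pos :: "'a set set"
  neg :: "'a set set"
  unres :: "'a set set"

definition initial_state :: "'a set \<Rightarrow> 'a cstate" where
  "initial_state V =
     \<lparr>parts = (\<lambda>v. {v}) ` V, pos = {}, neg = {}, unres = nsets V 2\<rparr>"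

definition pairs_between :: "'a set \<Rightarrow> 'a set \<Rightarrow> 'a set set" where
  "pairs_between A B = {{a, b} | a b. a \<in> A \<and> b \<in> B}"

inductive cstep :: "'a cstate \<Rightarrow> 'a cstate \<Rightarrow> bool" where
  merge: "\<lbrakk>A \<in> parts s; B \<in> parts s; A \<noteq> B\<rbrakk> \<Longrightarrow>
    cstep s (s\<lparr>parts := insert (A \<union> B) (parts s - {A, B})\<rparr>)"
| resolve_pos: "\<lbrakk>A \<in> parts s; B \<in> parts s\<rbrakk> \<Longrightarrow>
    cstep s (s\<lparr>pos := pos s \<union> (unres s \<inter> pairs_between A B),
               unres := unres s - pairs_between A B\<rparr>)"
| resolve_neg: "\<lbrakk>A \<in> parts s; B \<in> parts s\<rbrakk> \<Longrightarrow>
    cstep s (s\<lparr>neg := neg s \<union> (unres s \<inter> pairs_between A B),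
               unres := unres s - pairs_between A B\<rparr>)"

text \<open>
  A construction sequence is given by the list of its states, the initial one included.
  For nonempty \<open>V\<close> there is always at least one part, so the bound on the number of parts says
  that the last partition has exactly one part; for \<open>V = {}\<close>, where the partition has no parts,
  it makes the initial state alone a construction sequence of the empty graph.
\<close>

definition construction_sequence :: "'a set \<Rightarrow> 'a cstate list \<Rightarrow> bool" where
  "construction_sequence V ss \<longleftrightarrow>
     ss \<noteq> [] \<and> hd ss = initial_state V \<and> successively cstep ss \<and>
     card (parts (last ss)) \<le> 1 \<and> unres (last ss) = {}"

definition construction_sequence_of :: "'a ugraph \<Rightarrow> 'a cstate list \<Rightarrow> bool" where
  "construction_sequence_of G ss \<longleftrightarrow>
     construction_sequence (verts G) ss \<and> pos (last ss) = edges G"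

definition reachable_parts :: "'a set \<Rightarrow> nat \<Rightarrow> 'a cstate \<Rightarrow> 'a \<Rightarrow> 'a set set" where
  "reachable_parts V r s v =
     {A \<in> parts s. \<exists>w\<in>A. reachable_within \<lparr>verts = V, edges = pos s \<union> neg s\<rparr> r v w}"

definition width :: "'a set \<Rightarrow> nat \<Rightarrow> 'a cstate list \<Rightarrow> nat" where
  "width V r ss = (LEAST k. \<forall>s\<in>set ss. \<forall>v\<in>V. card (reachable_parts V r s v) \<le> k)"

definition merge_width :: "nat \<Rightarrow> 'a ugraph \<Rightarrow> enat" where
  "merge_width r G = (INF ss\<in>{ss. construction_sequence_of G ss}. enat (width (verts G) r ss))"

definition bounded_merge_width :: "'a ugraph set \<Rightarrow> bool" where
  "bounded_merge_width \<C> \<longleftrightarrow> (\<forall>r. (SUP G\<in>\<C>. merge_width r G) < \<infinity>)"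

end

theory Submission
  imports Defs "HOL-Library.Disjoint_Sets"
begin

text \<open>
  Fix a construction sequence of \<open>G\<close> and a formula \<open>\<phi>(x, y)\<close>. At a state \<open>s\<close> of the sequence, view
  \<open>G\<close> as a structure whose vertices are labelled by their part and their colours, and whose binary
  relations are adjacency and the relation \<open>R\<close> of being a resolved pair. All unresolved pairs between two
  given parts will be resolved in the same way, so adjacency outside \<open>R\<close> depends on the labels only
  (\<open>unresolved_decided_by_parts\<close>). Distances measured in \<open>R\<close> are therefore a sound notion of locality
  for the whole structure, and bounded width says that balls of bounded radius contain few labels.

  Gaifman's locality argument then gives a rank-\<open>q\<close> type of a vertex with two properties. If
  \<open>(u, v)\<close> and \<open>(u', v')\<close> are pairs at large \<open>R\<close>-distance with equal types at \<open>u, u'\<close> and at \<open>v, v'\<close>, then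
  \<open>\<phi>\<close> does not distinguish the pairs (\<open>glob_far_pair\<close>, \<open>sat_glob\<close>). And the number of
  types met in a ball is bounded in terms of the number of labels met in a larger ball
  (\<open>glob_colouring\<close>). Both rest on \<open>loc_imp_glob\<close>: tuples that agree on a local version of the
  Ehrenfeucht-Fraisse game, in which pebbles stay near earlier pebbles, agree on the unrestricted game.

  The construction sequence for the transduced graph \<open>H\<close> follows that of \<open>G\<close>. At \<open>s\<close> its parts are the
  classes of equal type, and its resolved pairs include all pairs at small \<open>R\<close>-distance, so that
  the remaining pairs between two classes are either all edges or all non-edges of \<open>H\<close>. The structure
  at the next state is definable without quantifiers in the one at \<open>s\<close>, so classes only grow. When a
  step of the given sequence brings some pair close together, the types force every unresolved pair between the
  same two classes to come fairly close as well (\<open>newly_near\<close>), hence these classes can be resolved against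
  each other while resolved pairs of \<open>H\<close> keep a bounded \<open>R\<close>-distance. A ball of radius \<open>r\<close> around a vertex of
  \<open>H\<close> is thus contained in a ball of bounded radius of \<open>R\<close>, which meets boundedly many classes
  (\<open>narrow_classes\<close>, \<open>follow_step\<close>).

  Types are taken with respect to the unrestricted game because these are preserved from state to state;
  local types are not, since distances shrink when pairs get resolved.
\<close>

section \<open>Distance in a relation\<close>

definition near :: "'a rel \<Rightarrow> nat \<Rightarrow> 'a rel" where
  "near R d = (R\<^sup>=) ^^ d"

lemma near_0 [simp]: "(a, b) \<in> near R 0 \<longleftrightarrow> a = b"
  by (simp add: near_def)

lemma near_refl [simp]: "(a, a) \<in> near R d"
  unfolding near_def by (induction d) auto

lemma near_1 [simp]: "near R (Suc 0) = R\<^sup>="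
  by (simp add: near_def)

lemma near_trans: "(a, b) \<in> near R d \<Longrightarrow> (b, c) \<in> near R e \<Longrightarrow> (a, c) \<in> near R (d + e)"
  unfolding near_def by (auto simp: relpow_add)

lemma near_SucE:
  assumes "(a, b) \<in> near R (Suc d)"
  obtains c where "(a, c) \<in> near R d" "(c, b) \<in> R\<^sup>="
  using assms unfolding near_def by auto

lemma near_SucI: "(a, c) \<in> near R d \<Longrightarrow> (c, b) \<in> R\<^sup>= \<Longrightarrow> (a, b) \<in> near R (Suc d)"
  unfolding near_def by auto

lemma near_mono: "(a, b) \<in> near R d \<Longrightarrow> d \<le> e \<Longrightarrow> (a, b) \<in> near R e"
  using near_trans[of a b R d b "e - d"] by simp

lemma near_rel_mono: "R \<subseteq> R' \<Longrightarrow> (a, b) \<in> near R d \<Longrightarrow> (a, b) \<in> near R' d"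
proof (induction d arbitrary: b)
  case (Suc d)
  then show ?case by (elim near_SucE) (auto intro!: near_SucI)
qed simp

lemma near_sym:
  assumes "sym R" "(a, b) \<in> near R d"
  shows "(b, a) \<in> near R d"
  using assms(2)
proof (induction d arbitrary: b)
  case (Suc d)
  then obtain c where "(c, a) \<in> near R d" "(c, b) \<in> R\<^sup>=" by (blast elim: near_SucE)
  then have "(b, c) \<in> near R (Suc 0)" using assms(1) by (auto dest: symD)
  from near_trans[OF this \<open>(c, a) \<in> near R d\<close>] show ?case by simp
qed simp

lemma converse_insert: "(insert (a, b) T)\<inverse> = insert (b, a) (T\<inverse>)"
  by auto

section \<open>Back-and-forth games\<close>

text \<open>
  A position is the set of pairs of pebbled elements of one and the same structure, which is compared with
  itself. The parameter \<open>ok\<close> restricts the positions, and \<open>nb q S\<close> is the set of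
  elements that may be pebbled next when \<open>S\<close> is pebbled on that side and \<open>q\<close> rounds remain afterwards.
\<close>

primrec back_forth ::
  "'a set \<Rightarrow> (nat \<Rightarrow> 'a rel \<Rightarrow> bool) \<Rightarrow> (nat \<Rightarrow> 'a set \<Rightarrow> 'a set) \<Rightarrow> nat \<Rightarrow> 'a rel \<Rightarrow> bool"
where
  "back_forth V ok nb 0 T \<longleftrightarrow> ok 0 T"
| "back_forth V ok nb (Suc q) T \<longleftrightarrow> ok (Suc q) T \<and>
     (\<forall>b\<in>nb q (Domain T). \<exists>b'\<in>V. back_forth V ok nb q (insert (b, b') T)) \<and>
     (\<forall>b'\<in>nb q (Range T). \<exists>b\<in>V. back_forth V ok nb q (insert (b, b') T))"

text \<open>
  What the unrestricted game and the local game, where new pebbles stay near old ones, have in common.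
  The last assumption says that the answer to a legal move is legal for the other player as well;
  transitivity depends on it.
\<close>

locale back_and_forth =
  fixes V :: "'a set" and ok :: "nat \<Rightarrow> 'a rel \<Rightarrow> bool" and nb :: "nat \<Rightarrow> 'a set \<Rightarrow> 'a set"
  assumes ok_subset: "ok q T \<Longrightarrow> T' \<subseteq> T \<Longrightarrow> ok q T'"
    and ok_converse: "ok q T \<Longrightarrow> ok q (T\<inverse>)"
    and ok_trans: "ok q ((\<lambda>(a, b, c). (a, b)) ` X) \<Longrightarrow> ok q ((\<lambda>(a, b, c). (b, c)) ` X) \<Longrightarrow>
      ok q ((\<lambda>(a, b, c). (a, c)) ` X)"
    and ok_Id: "T \<subseteq> Id \<Longrightarrow> ok q T"
    and ok_Suc: "ok (Suc q) T \<Longrightarrow> ok q T"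
    and nb_V: "nb q S \<subseteq> V"
    and nb_mono: "S \<subseteq> S' \<Longrightarrow> nb q S \<subseteq> nb q S'"
    and nb_Suc: "nb q S \<subseteq> nb (Suc q) S"
    and nb_ok: "ok q (insert (b, b') T) \<Longrightarrow> b \<in> nb q (Domain T) \<Longrightarrow> b' \<in> V \<Longrightarrow> b' \<in> nb q (Range T)"
begin

abbreviation "bf \<equiv> back_forth V ok nb"

lemma bf_ok: "bf q T \<Longrightarrow> ok q T"
  by (cases q) auto

lemma bf_forth:
  assumes "bf (Suc q) T" "b \<in> nb q (Domain T)"
  obtains b' where "b' \<in> V" "bf q (insert (b, b') T)"
  using assms by auto

lemma bf_back:
  assumes "bf (Suc q) T" "b' \<in> nb q (Range T)"
  obtains b where "b \<in> V" "bf q (insert (b, b') T)"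
  using assms by auto

lemma bf_subset: "bf q T \<Longrightarrow> T' \<subseteq> T \<Longrightarrow> bf q T'"
proof (induction q arbitrary: T T')
  case 0
  then show ?case using ok_subset by auto
next
  case (Suc q)
  have "\<exists>b'\<in>V. bf q (insert (b, b') T')" if "b \<in> nb q (Domain T')" for b
  proof -
    have "b \<in> nb q (Domain T)" using that nb_mono[OF Domain_mono[OF Suc.prems(2)]] by auto
    then obtain b' where "b' \<in> V" "bf q (insert (b, b') T)" using Suc.prems(1) by auto
    then show ?thesis using Suc.IH[of "insert (b, b') T" "insert (b, b') T'"] Suc.prems(2) by blast
  qed
  moreover have "\<exists>b\<in>V. bf q (insert (b, b') T')" if "b' \<in> nb q (Range T')" for b'
  proof -
    have "b' \<in> nb q (Range T)" using that nb_mono[OF Range_mono[OF Suc.prems(2)]] by auto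
    then obtain b where "b \<in> V" "bf q (insert (b, b') T)" using Suc.prems(1) by auto
    then show ?thesis using Suc.IH[of "insert (b, b') T" "insert (b, b') T'"] Suc.prems(2) by blast
  qed
  ultimately show ?case using ok_subset Suc.prems by auto
qed

lemma bf_converse: "bf q T \<Longrightarrow> bf q (T\<inverse>)"
proof (induction q arbitrary: T)
  case 0
  then show ?case using ok_converse by auto
next
  case (Suc q)
  have *: "bf q (insert (b, b') (T\<inverse>))" if "bf q (insert (b', b) T)" for b b'
    using Suc.IH[OF that] by (simp add: converse_insert)
  have "\<exists>b'\<in>V. bf q (insert (b, b') (T\<inverse>))" if "b \<in> nb q (Domain (T\<inverse>))" for b
    using Suc.prems that * by (metis Domain_converse bf_back)
  moreover have "\<exists>b\<in>V. bf q (insert (b, b') (T\<inverse>))" if "b' \<in> nb q (Range (T\<inverse>))" for b'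
    using Suc.prems that * by (metis Range_converse bf_forth)
  ultimately show ?case using ok_converse Suc.prems by auto
qed

lemma bf_Id: "T \<subseteq> Id \<Longrightarrow> bf q T"
proof (induction q arbitrary: T)
  case 0
  then show ?case using ok_Id by auto
next
  case (Suc q)
  then have "bf q (insert (b, b) T)" for b by simp
  then show ?case using ok_Id[OF Suc.prems] subsetD[OF nb_V] by auto metis+
qed

lemma bf_Suc: "bf (Suc q) T \<Longrightarrow> bf q T"
proof (induction q arbitrary: T)
  case 0
  then show ?case using ok_Suc by auto
next
  case (Suc q)
  have "\<exists>b'\<in>V. bf q (insert (b, b') T)" if "b \<in> nb q (Domain T)" for b
    by (metis Suc.IH Suc.prems bf_forth nb_Suc subsetD that)
  moreover have "\<exists>b\<in>V. bf q (insert (b, b') T)" if "b' \<in> nb q (Range T)" for b'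
    by (metis Suc.IH Suc.prems bf_back nb_Suc subsetD that)
  ultimately show ?case using ok_Suc[of "Suc q"] bf_ok[OF Suc.prems] by auto
qed

lemma bf_rank_mono: "bf p T \<Longrightarrow> q \<le> p \<Longrightarrow> bf q T"
proof (induction p)
  case (Suc p)
  show ?case
  proof (cases "q = Suc p")
    case False
    then show ?thesis using Suc.IH[OF bf_Suc[OF Suc.prems(1)]] Suc.prems(2) by linarith
  qed (use Suc.prems in simp)
qed simp

text \<open>
  For positions as sets of pairs, composition has to remember which pairs are matched; hence the set of
  triples.
\<close>

lemma bf_trans:
  "bf q ((\<lambda>(a, b, c). (a, b)) ` X) \<Longrightarrow> bf q ((\<lambda>(a, b, c). (b, c)) ` X) \<Longrightarrow>
    bf q ((\<lambda>(a, b, c). (a, c)) ` X)"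
proof (induction q arbitrary: X)
  case 0
  then show ?case using ok_trans[of 0 X] by (simp only: back_forth.simps)
next
  case (Suc q)
  let ?T = "(\<lambda>(a, b, c). (a, b)) ` X" and ?U = "(\<lambda>(a, b, c). (b, c)) ` X"
    and ?W = "(\<lambda>(a, b, c). (a, c)) ` X"
  have dom: "Domain ?W = Domain ?T" "Range ?T = Domain ?U" "Range ?W = Range ?U" by force+
  have step: "bf q (insert (a, c) ?W)"
    if "bf q (insert (a, b) ?T)" "bf q (insert (b, c) ?U)" for a b c
    using Suc.IH[of "insert (a, b, c) X"] that by (simp only: image_insert prod.case)
  have "\<exists>c\<in>V. bf q (insert (a, c) ?W)" if a: "a \<in> nb q (Domain ?W)" for a
  proof -
    obtain b where b: "b \<in> V" "bf q (insert (a, b) ?T)"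
      using Suc.prems(1) a unfolding dom by (rule bf_forth)
    have "b \<in> nb q (Range ?T)" using nb_ok[OF bf_ok[OF b(2)]] a b(1) unfolding dom by blast
    then obtain c where "c \<in> V" "bf q (insert (b, c) ?U)"
      using Suc.prems(2) unfolding dom by (blast elim: bf_forth)
    then show ?thesis using step[OF b(2)] by blast
  qed
  moreover have "\<exists>a\<in>V. bf q (insert (a, c) ?W)" if c: "c \<in> nb q (Range ?W)" for c
  proof -
    obtain b where b: "b \<in> V" "bf q (insert (b, c) ?U)"
      using Suc.prems(2) c unfolding dom by (rule bf_back)
    have "ok q (insert (c, b) (?U\<inverse>))" using ok_converse[OF bf_ok[OF b(2)]] by (simp add: converse_insert)
    then have "b \<in> nb q (Domain ?U)" using nb_ok[of q c b "?U\<inverse>"] c b(1) unfolding dom Domain_converse Range_converse by blast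
    then obtain a where "a \<in> V" "bf q (insert (a, b) ?T)"
      using Suc.prems(1) unfolding dom(2)[symmetric] by (blast elim: bf_back)
    then show ?thesis using step b(2) by blast
  qed
  ultimately show ?case using ok_trans[OF bf_ok[OF Suc.prems(1)] bf_ok[OF Suc.prems(2)]] by auto
qed

lemma bf_trans1:
  assumes "bf q {(a, b)}" "bf q {(b, c)}" shows "bf q {(a, c)}"
  using bf_trans[of q "{(a, b, c)}"] assms by simp

lemma bf_sym1: "bf q {(a, b)} \<Longrightarrow> bf q {(b, a)}"
  using bf_converse[of q "{(a, b)}"] by (simp add: converse_insert)

end

section \<open>Global and local equivalence\<close>

definition partial_iso :: "'a rel \<Rightarrow> 'a rel \<Rightarrow> ('a \<Rightarrow> 'l) \<Rightarrow> 'a rel \<Rightarrow> bool" where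
  "partial_iso R E lab T \<longleftrightarrow>
     (\<forall>a a'. (a, a') \<in> T \<longrightarrow> lab a = lab a') \<and>
     (\<forall>a a' b b'. (a, a') \<in> T \<longrightarrow> (b, b') \<in> T \<longrightarrow>
        (a = b \<longleftrightarrow> a' = b') \<and> ((a, b) \<in> R \<longleftrightarrow> (a', b') \<in> R) \<and> ((a, b) \<in> E \<longleftrightarrow> (a', b') \<in> E))"

definition same_distances :: "'a rel \<Rightarrow> nat \<Rightarrow> 'a rel \<Rightarrow> bool" where
  "same_distances R d T \<longleftrightarrow>
     (\<forall>a a' b b' e. (a, a') \<in> T \<longrightarrow> (b, b') \<in> T \<longrightarrow> e \<le> d \<longrightarrow> ((a, b) \<in> near R e \<longleftrightarrow> (a', b') \<in> near R e))"

text \<open>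
  Duplicator wins the Ehrenfeucht-Fraisse game with \<open>q\<close> rounds, started in the given position.
\<close>

definition global_equiv ::
  "'a set \<Rightarrow> 'a rel \<Rightarrow> 'a rel \<Rightarrow> ('a \<Rightarrow> 'l) \<Rightarrow> nat \<Rightarrow> 'a rel \<Rightarrow> bool" where
  "global_equiv V R E lab = back_forth V (\<lambda>_. partial_iso R E lab) (\<lambda>_ _. V)"

text \<open>
  With \<open>q\<close> rounds to go, distances up to \<open>2 ^ q\<close> must agree and the next pebble is within \<open>2 ^ (q - 1)\<close> of
  an earlier one. As radii double with each round, two positions farther apart than \<open>2 ^ q\<close> never
  interact during the rest of the game.
\<close>

definition local_equiv ::
  "'a set \<Rightarrow> 'a rel \<Rightarrow> 'a rel \<Rightarrow> ('a \<Rightarrow> 'l) \<Rightarrow> nat \<Rightarrow> 'a rel \<Rightarrow> bool" where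
  "local_equiv V R E lab = back_forth V
     (\<lambda>q T. partial_iso R E lab T \<and> same_distances R (2 ^ q) T)
     (\<lambda>q S. {b \<in> V. \<exists>a\<in>S. (a, b) \<in> near R (2 ^ q)})"

lemma partial_iso_simps:
  "partial_iso R E lab T \<Longrightarrow> (a, a') \<in> T \<Longrightarrow> lab a = lab a'"
  "partial_iso R E lab T \<Longrightarrow> (a, a') \<in> T \<Longrightarrow> (b, b') \<in> T \<Longrightarrow> a = b \<longleftrightarrow> a' = b'"
  "partial_iso R E lab T \<Longrightarrow> (a, a') \<in> T \<Longrightarrow> (b, b') \<in> T \<Longrightarrow> (a, b) \<in> R \<longleftrightarrow> (a', b') \<in> R"
  "partial_iso R E lab T \<Longrightarrow> (a, a') \<in> T \<Longrightarrow> (b, b') \<in> T \<Longrightarrow> (a, b) \<in> E \<longleftrightarrow> (a', b') \<in> E"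
  unfolding partial_iso_def by blast+

lemma partial_isoI:
  assumes "\<And>a a'. (a, a') \<in> T \<Longrightarrow> lab a = lab a'"
    and "\<And>a a' b b'. (a, a') \<in> T \<Longrightarrow> (b, b') \<in> T \<Longrightarrow>
      (a = b \<longleftrightarrow> a' = b') \<and> ((a, b) \<in> R \<longleftrightarrow> (a', b') \<in> R) \<and> ((a, b) \<in> E \<longleftrightarrow> (a', b') \<in> E)"
  shows "partial_iso R E lab T"
  unfolding partial_iso_def using assms by simp

lemma partial_iso_subset: "partial_iso R E lab T \<Longrightarrow> T' \<subseteq> T \<Longrightarrow> partial_iso R E lab T'"
  unfolding partial_iso_def by blast

lemma partial_iso_converse: "partial_iso R E lab T \<Longrightarrow> partial_iso R E lab (T\<inverse>)"
  unfolding partial_iso_def by simp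

lemma partial_iso_trans:
  assumes "partial_iso R E lab ((\<lambda>(a, b, c). (a, b)) ` X)" "partial_iso R E lab ((\<lambda>(a, b, c). (b, c)) ` X)"
  shows "partial_iso R E lab ((\<lambda>(a, b, c). (a, c)) ` X)"
proof (rule partial_isoI)
  have mem: "(a, b) \<in> (\<lambda>(a, b, c). (a, b)) ` X" "(b, c) \<in> (\<lambda>(a, b, c). (b, c)) ` X"
    if "(a, b, c) \<in> X" for a b c
    using that by force+
  fix a c assume "(a, c) \<in> (\<lambda>(a, b, c). (a, c)) ` X"
  then obtain b where abc: "(a, b, c) \<in> X" by auto
  show "lab a = lab c"
    using partial_iso_simps(1)[OF assms(1) mem(1)[OF abc]] partial_iso_simps(1)[OF assms(2) mem(2)[OF abc]]
    by simp
  fix a' c' assume "(a', c') \<in> (\<lambda>(a, b, c). (a, c)) ` X"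
  then obtain b' where abc': "(a', b', c') \<in> X" by auto
  show "(a = a' \<longleftrightarrow> c = c') \<and> ((a, a') \<in> R \<longleftrightarrow> (c, c') \<in> R) \<and> ((a, a') \<in> E \<longleftrightarrow> (c, c') \<in> E)"
    using partial_iso_simps(2-)[OF assms(1) mem(1)[OF abc] mem(1)[OF abc']]
      partial_iso_simps(2-)[OF assms(2) mem(2)[OF abc] mem(2)[OF abc']] by simp
qed

lemma partial_iso_Id: "T \<subseteq> Id \<Longrightarrow> partial_iso R E lab T"
  by (rule partial_isoI) auto

lemma same_distancesD:
  "same_distances R d T \<Longrightarrow> (a, a') \<in> T \<Longrightarrow> (b, b') \<in> T \<Longrightarrow> e \<le> d \<Longrightarrow>
    (a, b) \<in> near R e \<longleftrightarrow> (a', b') \<in> near R e"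
  unfolding same_distances_def by blast

lemma same_distances_subset: "same_distances R d T \<Longrightarrow> T' \<subseteq> T \<Longrightarrow> same_distances R d T'"
  unfolding same_distances_def by blast

lemma same_distances_converse: "same_distances R d T \<Longrightarrow> same_distances R d (T\<inverse>)"
  unfolding same_distances_def by simp

lemma same_distances_trans:
  assumes "same_distances R d ((\<lambda>(a, b, c). (a, b)) ` X)" "same_distances R d ((\<lambda>(a, b, c). (b, c)) ` X)"
  shows "same_distances R d ((\<lambda>(a, b, c). (a, c)) ` X)"
  unfolding same_distances_def
proof (intro allI impI)
  have mem: "(a, b) \<in> (\<lambda>(a, b, c). (a, b)) ` X" "(b, c) \<in> (\<lambda>(a, b, c). (b, c)) ` X"
    if "(a, b, c) \<in> X" for a b c
    using that by force+
  fix a c a' c' e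
  assume "(a, c) \<in> (\<lambda>(a, b, c). (a, c)) ` X" "(a', c') \<in> (\<lambda>(a, b, c). (a, c)) ` X" and e: "e \<le> d"
  then obtain b b' where abc: "(a, b, c) \<in> X" "(a', b', c') \<in> X" by auto
  show "(a, a') \<in> near R e \<longleftrightarrow> (c, c') \<in> near R e"
    using same_distancesD[OF assms(1) mem(1)[OF abc(1)] mem(1)[OF abc(2)] e]
      same_distancesD[OF assms(2) mem(2)[OF abc(1)] mem(2)[OF abc(2)] e] by simp
qed

lemma same_distances_Id: "T \<subseteq> Id \<Longrightarrow> same_distances R d T"
  unfolding same_distances_def by (metis IdE subsetD prod.inject)

lemma same_distances_mono: "same_distances R e T \<Longrightarrow> d \<le> e \<Longrightarrow> same_distances R d T"
  unfolding same_distances_def by (meson order_trans)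

text \<open>
  \<open>R\<close> plays the role of the Gaifman graph: outside of \<open>R\<close>, the relation \<open>E\<close> depends on labels only.
\<close>

locale labelled_structure =
  fixes V :: "'a set" and R E :: "'a rel" and lab :: "'a \<Rightarrow> 'l"
  assumes V_finite: "finite V"
    and R_V: "R \<subseteq> V \<times> V" and R_sym: "sym R" and R_irrefl: "irrefl R"
    and E_sym: "sym E"
    and E_far: "\<lbrakk>u \<in> V; v \<in> V; u' \<in> V; v' \<in> V; (u, v) \<notin> R\<^sup>=; (u', v') \<notin> R\<^sup>=;
      lab u = lab u'; lab v = lab v'\<rbrakk> \<Longrightarrow> (u, v) \<in> E \<longleftrightarrow> (u', v') \<in> E"
begin

sublocale glob: back_and_forth V "\<lambda>_. partial_iso R E lab" "\<lambda>_ _. V"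
  by unfold_locales
    (auto simp: partial_iso_subset partial_iso_converse partial_iso_Id intro: partial_iso_trans)

sublocale loc: back_and_forth V
  "\<lambda>q T. partial_iso R E lab T \<and> same_distances R (2 ^ q) T"
  "\<lambda>q S. {b \<in> V. \<exists>a\<in>S. (a, b) \<in> near R (2 ^ q)}"
proof unfold_locales
  fix q b b' T
  assume T: "partial_iso R E lab (insert (b, b') T) \<and> same_distances R (2 ^ q) (insert (b, b') T)"
    and b: "b \<in> {b \<in> V. \<exists>a\<in>Domain T. (a, b) \<in> near R (2 ^ q)}" and b': "b' \<in> V"
  from b obtain a a' where "(a, a') \<in> T" "(a, b) \<in> near R (2 ^ q)" by blast
  then have "(a', b') \<in> near R (2 ^ q)"
    using same_distancesD[OF T[THEN conjunct2], of a a' b b' "2 ^ q"] by blast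
  then show "b' \<in> {b \<in> V. \<exists>a\<in>Range T. (a, b) \<in> near R (2 ^ q)}"
    using \<open>(a, a') \<in> T\<close> b' by blast
next
  fix q S
  show "{b \<in> V. \<exists>a\<in>S. (a, b) \<in> near R (2 ^ q)} \<subseteq> {b \<in> V. \<exists>a\<in>S. (a, b) \<in> near R (2 ^ Suc q)}"
    using near_mono[of _ _ R "2 ^ q" "2 ^ Suc q"] by auto
next
  fix q T
  assume "partial_iso R E lab T \<and> same_distances R (2 ^ Suc q) T"
  then show "partial_iso R E lab T \<and> same_distances R (2 ^ q) T"
    by (auto intro: same_distances_mono)
next
  fix q T T'
  assume "partial_iso R E lab T \<and> same_distances R (2 ^ q) T" "T' \<subseteq> T"
  then show "partial_iso R E lab T' \<and> same_distances R (2 ^ q) T'"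
    using partial_iso_subset same_distances_subset by metis
qed (simp_all add: partial_iso_converse partial_iso_Id same_distances_converse same_distances_Id
    partial_iso_trans same_distances_trans, auto)

lemma near_commute: "(a, b) \<in> near R d \<longleftrightarrow> (b, a) \<in> near R d"
  using near_sym[OF R_sym] by metis

abbreviation "glob \<equiv> global_equiv V R E lab"
abbreviation "loc \<equiv> local_equiv V R E lab"

lemma glob_eq: "glob.bf q T \<longleftrightarrow> glob q T"
  by (simp add: global_equiv_def)

lemma loc_eq: "loc.bf q T \<longleftrightarrow> loc q T"
  by (simp add: local_equiv_def)

lemmas glob_converse = glob.bf_converse[unfolded glob_eq]
  and glob_Id = glob.bf_Id[unfolded glob_eq]
  and glob_rank_mono = glob.bf_rank_mono[unfolded glob_eq]
  and glob_trans1 = glob.bf_trans1[unfolded glob_eq]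
  and glob_sym1 = glob.bf_sym1[unfolded glob_eq]
  and glob_iso = glob.bf_ok[unfolded glob_eq]
  and glob_forth = glob.bf_forth[unfolded glob_eq]
  and glob_back = glob.bf_back[unfolded glob_eq]
  and glob_0 = back_forth.simps(1)[of V "\<lambda>_. partial_iso R E lab" "\<lambda>_ _. V", unfolded glob_eq]
  and glob_unfold = back_forth.simps(2)[of V "\<lambda>_. partial_iso R E lab" "\<lambda>_ _. V", unfolded glob_eq]

lemmas loc_subset = loc.bf_subset[unfolded loc_eq]
  and loc_converse = loc.bf_converse[unfolded loc_eq]
  and loc_Id = loc.bf_Id[unfolded loc_eq]
  and loc_rank_mono = loc.bf_rank_mono[unfolded loc_eq]
  and loc_Suc = loc.bf_Suc[unfolded loc_eq]
  and loc_trans1 = loc.bf_trans1[unfolded loc_eq]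
  and loc_sym1 = loc.bf_sym1[unfolded loc_eq]
  and loc_ok = loc.bf_ok[unfolded loc_eq]
  and loc_forth = loc.bf_forth[unfolded loc_eq]
  and loc_back = loc.bf_back[unfolded loc_eq]
  and loc_0 = back_forth.simps(1)[of V
     "\<lambda>q T. partial_iso R E lab T \<and> same_distances R (2 ^ q) T"
     "\<lambda>q S. {b \<in> V. \<exists>a\<in>S. (a, b) \<in> near R (2 ^ q)}", unfolded loc_eq]
  and loc_unfold = back_forth.simps(2)[of V
     "\<lambda>q T. partial_iso R E lab T \<and> same_distances R (2 ^ q) T"
     "\<lambda>q S. {b \<in> V. \<exists>a\<in>S. (a, b) \<in> near R (2 ^ q)}", unfolded loc_eq]

lemmas loc_iso = loc_ok[THEN conjunct1]
  and loc_dist = loc_ok[THEN conjunct2]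

lemma loc_near_iff:
  "loc q T \<Longrightarrow> (a, a') \<in> T \<Longrightarrow> (b, b') \<in> T \<Longrightarrow> d \<le> 2 ^ q \<Longrightarrow> (a, b) \<in> near R d \<longleftrightarrow> (a', b') \<in> near R d"
  using same_distancesD[OF loc_dist] .

lemma partial_iso_far_Un:
  assumes S: "partial_iso R E lab S" "S \<subseteq> V \<times> V" and T: "partial_iso R E lab T" "T \<subseteq> V \<times> V"
    and far: "\<And>a a' b b'. (a, a') \<in> S \<Longrightarrow> (b, b') \<in> T \<Longrightarrow> (a, b) \<notin> R\<^sup>= \<and> (a', b') \<notin> R\<^sup>="
  shows "partial_iso R E lab (S \<union> T)"
proof -
  have cross: "(a = b \<longleftrightarrow> a' = b') \<and> ((a, b) \<in> R \<longleftrightarrow> (a', b') \<in> R) \<and> ((a, b) \<in> E \<longleftrightarrow> (a', b') \<in> E)"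
    "(b = a \<longleftrightarrow> b' = a') \<and> ((b, a) \<in> R \<longleftrightarrow> (b', a') \<in> R) \<and> ((b, a) \<in> E \<longleftrightarrow> (b', a') \<in> E)"
    if "(a, a') \<in> S" "(b, b') \<in> T" for a a' b b'
  proof -
    have "lab a = lab a'" "lab b = lab b'"
      using that S(1) T(1) by (auto dest: partial_iso_simps(1))
    moreover have "a \<in> V" "a' \<in> V" "b \<in> V" "b' \<in> V" using that S(2) T(2) by auto
    ultimately have "(a, b) \<in> E \<longleftrightarrow> (a', b') \<in> E"
      using E_far far[OF that] by blast
    then show "(a = b \<longleftrightarrow> a' = b') \<and> ((a, b) \<in> R \<longleftrightarrow> (a', b') \<in> R) \<and> ((a, b) \<in> E \<longleftrightarrow> (a', b') \<in> E)"
      "(b = a \<longleftrightarrow> b' = a') \<and> ((b, a) \<in> R \<longleftrightarrow> (b', a') \<in> R) \<and> ((b, a) \<in> E \<longleftrightarrow> (b', a') \<in> E)"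
      using far[OF that] R_sym E_sym by (auto dest: symD)
  qed
  show ?thesis
  proof (rule partial_isoI)
    fix a a' assume "(a, a') \<in> S \<union> T"
    then show "lab a = lab a'"
      using partial_iso_simps(1)[OF S(1)] partial_iso_simps(1)[OF T(1)] by blast
  next
    fix a a' b b' assume "(a, a') \<in> S \<union> T" "(b, b') \<in> S \<union> T"
    then consider (SS) "(a, a') \<in> S" "(b, b') \<in> S" | (TT) "(a, a') \<in> T" "(b, b') \<in> T"
      | (ST) "(a, a') \<in> S" "(b, b') \<in> T" | (TS) "(a, a') \<in> T" "(b, b') \<in> S"
      by blast
    then show "(a = b \<longleftrightarrow> a' = b') \<and> ((a, b) \<in> R \<longleftrightarrow> (a', b') \<in> R) \<and> ((a, b) \<in> E \<longleftrightarrow> (a', b') \<in> E)"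
    proof cases
      case SS
      show ?thesis using partial_iso_simps(2-4)[OF S(1) SS] by blast
    next
      case TT
      show ?thesis using partial_iso_simps(2-4)[OF T(1) TT] by blast
    next
      case ST
      show ?thesis by (rule cross(1)[OF ST])
    next
      case TS
      show ?thesis by (rule cross(2)[OF TS(2,1)])
    qed
  qed
qed

lemma same_distances_far_Un:
  assumes S: "same_distances R d S" and T: "same_distances R d T"
    and far: "\<And>a a' b b'. (a, a') \<in> S \<Longrightarrow> (b, b') \<in> T \<Longrightarrow> (a, b) \<notin> near R d \<and> (a', b') \<notin> near R d"
  shows "same_distances R d (S \<union> T)"
proof -
  have cross: "(a, b) \<notin> near R e \<and> (a', b') \<notin> near R e" "(b, a) \<notin> near R e \<and> (b', a') \<notin> near R e"
    if "(a, a') \<in> S" "(b, b') \<in> T" "e \<le> d" for a a' b b' e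
    using far[OF that(1,2)] near_mono[of _ _ R, OF _ that(3)] unfolding near_commute[of b] near_commute[of b']
    by blast+
  show ?thesis
    unfolding same_distances_def
  proof (intro allI impI)
    fix a a' b b' e assume "(a, a') \<in> S \<union> T" "(b, b') \<in> S \<union> T" and e: "e \<le> d"
    then consider (SS) "(a, a') \<in> S" "(b, b') \<in> S" | (TT) "(a, a') \<in> T" "(b, b') \<in> T"
      | (ST) "(a, a') \<in> S" "(b, b') \<in> T" | (TS) "(a, a') \<in> T" "(b, b') \<in> S"
      by blast
    then show "(a, b) \<in> near R e \<longleftrightarrow> (a', b') \<in> near R e"
    proof cases
      case SS
      show ?thesis by (rule same_distancesD[OF S SS e])
    next
      case TT
      show ?thesis by (rule same_distancesD[OF T TT e])
    next
      case ST
      show ?thesis using cross(1)[OF ST e] by blast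
    next
      case TS
      show ?thesis using cross(2)[OF TS(2,1) e] by blast
    qed
  qed
qed

text \<open>
  The feature that makes local equivalence useful: a Feferman-Vaught argument. A move near the first of two
  far positions is answered within the first, and \<open>2 ^ Suc q = 2 ^ q + 2 ^ q\<close> leaves the new pebble at a
  distance beyond \<open>2 ^ q\<close> from the second.
\<close>

lemma loc_compose:
  assumes "loc q S" "loc q T" "S \<subseteq> V \<times> V" "T \<subseteq> V \<times> V"
    and "\<And>a a' b b'. (a, a') \<in> S \<Longrightarrow> (b, b') \<in> T \<Longrightarrow> (a, b) \<notin> near R (2 ^ q) \<and> (a', b') \<notin> near R (2 ^ q)"
  shows "loc q (S \<union> T)"
  using assms
proof (induction q arbitrary: S T)
  case 0
  then show ?case
    using partial_iso_far_Un[of S T] same_distances_far_Un[of 1 S T] unfolding loc_0 by simp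
next
  case (Suc q)
  have not1: "(a, b) \<notin> R\<^sup>=" if "(a, b) \<notin> near R (2 ^ Suc q)" for a b
    using that near_mono[of a b R "Suc 0" "2 ^ Suc q"] by auto
  have atoms: "partial_iso R E lab (S \<union> T) \<and> same_distances R (2 ^ Suc q) (S \<union> T)"
    using partial_iso_far_Un[OF loc_iso[OF Suc.prems(1)] Suc.prems(3) loc_iso[OF Suc.prems(2)] Suc.prems(4)]
      same_distances_far_Un[OF loc_dist[OF Suc.prems(1)] loc_dist[OF Suc.prems(2)]] Suc.prems(5) not1
    by blast
  \<comment> \<open>It is enough to extend the first of two far positions, in the forward direction.\<close>
  have ext: "\<exists>b'\<in>V. loc q (insert (b, b') (S \<union> T))"
    if S: "loc (Suc q) S" and T: "loc (Suc q) T" and V: "S \<subseteq> V \<times> V" "T \<subseteq> V \<times> V"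
      and far: "\<And>a a' b b'. (a, a') \<in> S \<Longrightarrow> (b, b') \<in> T \<Longrightarrow>
          (a, b) \<notin> near R (2 ^ Suc q) \<and> (a', b') \<notin> near R (2 ^ Suc q)"
      and b: "b \<in> V" "(a, a') \<in> S" "(a, b) \<in> near R (2 ^ q)" for S T a a' b
  proof -
    obtain b' where b': "b' \<in> V" "loc q (insert (b, b') S)"
      using S b by (blast elim: loc_forth)
    have near': "(a', b') \<in> near R (2 ^ q)"
      using loc_near_iff[OF b'(2), of a a' b b' "2 ^ q"] b by simp
    have shift: "(y, z) \<notin> near R (2 ^ q)" if "(x, z) \<notin> near R (2 ^ Suc q)" "(x, y) \<in> near R (2 ^ q)" for x y z
      using near_trans[OF that(2), of z "2 ^ q"] that(1) by (auto simp: mult_2)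
    have weaken: "(x, z) \<notin> near R (2 ^ q)" if "(x, z) \<notin> near R (2 ^ Suc q)" for x z
      using that near_mono[of x z R "2 ^ q" "2 ^ Suc q"] by auto
    have "(x, z) \<notin> near R (2 ^ q) \<and> (x', z') \<notin> near R (2 ^ q)"
      if "(x, x') \<in> insert (b, b') S" "(z, z') \<in> T" for x x' z z'
      using that far[of _ _ z z'] b(2,3) near' shift weaken by (metis insertE prod.inject)
    moreover have "insert (b, b') S \<subseteq> V \<times> V" using V b b' by blast
    ultimately have "loc q (insert (b, b') S \<union> T)"
      using Suc.IH[OF b'(2) loc_Suc[OF T] _ V(2)] by blast
    then show ?thesis using b'(1) by auto
  qed
  have far_sym: "(b, a) \<notin> near R (2 ^ Suc q) \<and> (b', a') \<notin> near R (2 ^ Suc q)"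
    if "(a, a') \<in> S" "(b, b') \<in> T" for a a' b b'
    using Suc.prems(5)[OF that] unfolding near_commute[of b] near_commute[of b'] .
  have forward: "\<exists>b'\<in>V. loc q (insert (b, b') (S \<union> T))"
    if "b \<in> {b \<in> V. \<exists>a\<in>Domain (S \<union> T). (a, b) \<in> near R (2 ^ q)}" for b
  proof -
    from that obtain a a' where a: "b \<in> V" "(a, b) \<in> near R (2 ^ q)" "(a, a') \<in> S \<or> (a, a') \<in> T" by blast
    from a(3) show ?thesis
    proof
      assume "(a, a') \<in> S"
      from ext[OF Suc.prems a(1) this a(2)] show ?thesis .
    next
      assume "(a, a') \<in> T"
      from ext[OF Suc.prems(2,1,4,3) _ a(1) this a(2)] far_sym show ?thesis by (simp add: Un_commute)
    qed
  qed
  have backward: "\<exists>b\<in>V. loc q (insert (b, b') (S \<union> T))"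
    if "b' \<in> {b \<in> V. \<exists>a\<in>Range (S \<union> T). (a, b) \<in> near R (2 ^ q)}" for b'
  proof -
    from that obtain a a' where a: "b' \<in> V" "(a', b') \<in> near R (2 ^ q)" "(a, a') \<in> S \<or> (a, a') \<in> T" by blast
    note conv = loc_converse[OF Suc.prems(1)] loc_converse[OF Suc.prems(2)]
    have conV: "S\<inverse> \<subseteq> V \<times> V" "T\<inverse> \<subseteq> V \<times> V" using Suc.prems by auto
    from a(3) have "\<exists>b\<in>V. loc q (insert (b', b) (S\<inverse> \<union> T\<inverse>))"
    proof
      assume "(a, a') \<in> S"
      then have "(a', a) \<in> S\<inverse>" by simp
      from ext[OF conv conV _ a(1) this a(2)] Suc.prems(5) show ?thesis by blast
    next
      assume "(a, a') \<in> T"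
      then have "(a', a) \<in> T\<inverse>" by simp
      from ext[OF conv(2,1) conV(2,1) _ a(1) this a(2)] far_sym show ?thesis by (auto simp: Un_commute)
    qed
    then show ?thesis using loc_converse by (fastforce simp: converse_insert converse_Un)
  qed
  show ?case unfolding loc_unfold using atoms forward backward by blast
qed

end

section \<open>Gaifman locality\<close>

context labelled_structure
begin

text \<open>
  Transfers a finite set of elements near the right-hand side of a position to the left-hand side, all at
  once, for the price of one round each.
\<close>

lemma loc_pull_back:
  assumes "finite Y" "loc (p + card Y) T"
    and "\<And>y. y \<in> Y \<Longrightarrow> y \<in> V \<and> (\<exists>a'\<in>Range T. (a', y) \<in> near R (2 ^ p))"
  shows "\<exists>x. (\<forall>y\<in>Y. x y \<in> V) \<and> loc p (T \<union> (\<lambda>y. (x y, y)) ` Y)"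
  using assms
proof (induction Y arbitrary: T rule: finite_induct)
  case (insert y Y)
  obtain a' where a': "a' \<in> Range T" "(a', y) \<in> near R (2 ^ p)" "y \<in> V" using insert.prems(2) by blast
  have "(a', y) \<in> near R (2 ^ (p + card Y))"
    using near_mono[OF a'(2), of "2 ^ (p + card Y)"] by simp
  moreover have "loc (Suc (p + card Y)) T" using insert by simp
  ultimately obtain x\<^sub>0 where x0: "x\<^sub>0 \<in> V" "loc (p + card Y) (insert (x\<^sub>0, y) T)"
    using a' by (blast elim: loc_back)
  obtain x where x: "\<forall>y\<in>Y. x y \<in> V" "loc p (insert (x\<^sub>0, y) T \<union> (\<lambda>y. (x y, y)) ` Y)"
    using insert.IH[OF x0(2)] insert.prems(2) by blast
  have "insert (x\<^sub>0, y) T \<union> (\<lambda>y. (x y, y)) ` Y = T \<union> (\<lambda>z. ((x(y := x\<^sub>0)) z, z)) ` insert y Y"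
    using insert.hyps(2) by auto
  then show ?case using x x0(1) by (intro exI[of _ "x(y := x\<^sub>0)"]) auto
qed simp

text \<open>
  The heart of Gaifman's theorem, for a single structure. Near moves are answered locally. To a far move
  \<open>b\<close>, any \<open>b'\<close> of the same local type that is far from the right-hand side is an answer, by \<open>loc_compose\<close>.
  If there is none, all elements of the type of \<open>b\<close> cluster around the at most \<open>n\<close> pebbles on the right, so
  a largest scattered set \<open>Y\<close> of such elements has size at most \<open>n\<close>. Its copy near the left-hand side is
  again scattered and of that type, and adding \<open>b\<close>, which is far from it, gives a larger scattered set
  in the very same structure.
\<close>

lemma loc_forth_everywhere:
  assumes T: "finite T" "card T \<le> n" "T \<subseteq> V \<times> V" "loc (p + n + 3) T" and b: "b \<in> V"
  shows "\<exists>b'\<in>V. loc p (insert (b, b') T)"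
proof (cases "\<exists>a\<in>Domain T. (a, b) \<in> near R (2 ^ (p + n + 2))")
  case True
  have "loc (Suc (p + n + 2)) T" using T(4) by (simp add: numeral_3_eq_3)
  then obtain b' where "b' \<in> V" "loc (p + n + 2) (insert (b, b') T)"
    using True b by (blast elim: loc_forth)
  then show ?thesis using loc_rank_mono[of "p + n + 2" _ p] by auto
next
  case far: False
  show ?thesis
  proof (rule ccontr)
    assume none: "\<not> ?thesis"
    \<comment> \<open>The elements of the same local type as \<open>b\<close>.\<close>
    define X where "X = {c \<in> V. loc p {(b, c)}}"
    have far_T: "(b, a) \<notin> near R (2 ^ p)" if "(a, a') \<in> T" for a a'
    proof -
      have "(2::nat) ^ p \<le> 2 ^ (p + n + 2)" by (rule power_increasing) simp_all
      then have "(a, b) \<notin> near R (2 ^ p)"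
        using far that near_mono[of a b R "2 ^ p" "2 ^ (p + n + 2)"] by blast
      then show ?thesis by (simp add: near_commute[of b a])
    qed
    have loc_T: "loc m T" if "m \<le> p + n + 3" for m
      using loc_rank_mono[OF T(4) that] .
    have X_near: "\<exists>t\<in>T. (snd t, c) \<in> near R (2 ^ p)" if "c \<in> X" for c
    proof (rule ccontr)
      assume *: "\<not> (\<exists>t\<in>T. (snd t, c) \<in> near R (2 ^ p))"
      have c: "c \<in> V" "loc p {(b, c)}" using that by (auto simp: X_def)
      have "loc p ({(b, c)} \<union> T)"
      proof (rule loc_compose[OF c(2) loc_T _ T(3)])
        fix a a' e e' assume "(a, a') \<in> {(b, c)}" "(e, e') \<in> T"
        then show "(a, e) \<notin> near R (2 ^ p) \<and> (a', e') \<notin> near R (2 ^ p)"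
          using * far_T by (auto simp: near_commute[of c e'])
      qed (use b c in auto)
      then show False using none c(1) by auto
    qed
    define scattered where
      "scattered Y \<longleftrightarrow> Y \<subseteq> X \<and> (\<forall>y\<in>Y. \<forall>z\<in>Y. y \<noteq> z \<longrightarrow> (y, z) \<notin> near R (2 ^ Suc p))" for Y
    have "\<forall>Y. scattered Y \<longrightarrow> card Y < Suc (card V)"
      using card_mono[OF V_finite] by (auto simp: scattered_def X_def less_Suc_eq_le)
    then obtain Y where Y: "scattered Y" and Y_max: "\<And>Z. scattered Z \<Longrightarrow> card Z \<le> card Y"
      using ex_has_greatest_nat[of scattered "{}" card "Suc (card V)"] by (auto simp: scattered_def)
    have Y_X: "Y \<subseteq> X" using Y by (simp add: scattered_def)
    have Y_far: "(y, z) \<notin> near R (2 ^ Suc p)" if "y \<in> Y" "z \<in> Y" "y \<noteq> z" for y z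
      using Y that by (simp add: scattered_def)
    have YV: "Y \<subseteq> V" "finite Y"
      using Y_X V_finite by (auto simp: X_def intro: finite_subset)
    obtain h where h: "\<And>y. y \<in> Y \<Longrightarrow> h y \<in> T" "\<And>y. y \<in> Y \<Longrightarrow> (snd (h y), y) \<in> near R (2 ^ p)"
      using X_near Y_X by (metis subsetD)
    \<comment> \<open>Two points of \<open>Y\<close> cannot share a pebble, as both are within \<open>2 ^ p\<close> of theirs.\<close>
    have "inj_on h Y"
    proof (rule inj_onI)
      fix y z assume yz: "y \<in> Y" "z \<in> Y" "h y = h z"
      then have "(y, z) \<in> near R (2 ^ p + 2 ^ p)"
        using near_trans[of y "snd (h y)" R "2 ^ p" z "2 ^ p"] h(2)[of y] h(2)[of z]
        by (simp add: near_commute[of y])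
      then show "y = z" using yz Y_far[of y z] by (auto simp: mult_2)
    qed
    then have "card Y \<le> n"
      using card_inj_on_le[of h Y T] h(1) T(1,2) by fastforce
    then have "loc ((p + 2) + card Y) T" by (intro loc_T) simp
    moreover have "\<exists>a'\<in>Range T. (a', y) \<in> near R (2 ^ (p + 2))" if "y \<in> Y" for y
    proof
      show "snd (h y) \<in> Range T" using h(1)[OF that] by (metis Range.intros prod.collapse)
      show "(snd (h y), y) \<in> near R (2 ^ (p + 2))" by (rule near_mono[OF h(2)[OF that]]) simp
    qed
    ultimately obtain x where x: "\<And>y. y \<in> Y \<Longrightarrow> x y \<in> V" "loc (p + 2) (T \<union> (\<lambda>y. (x y, y)) ` Y)"
      using loc_pull_back[of Y "p + 2" T] YV by blast
    have xy: "(x y, y) \<in> T \<union> (\<lambda>y. (x y, y)) ` Y" if "y \<in> Y" for y using that by blast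
    have x_near_iff: "(x y, x z) \<in> near R (2 ^ Suc p) \<longleftrightarrow> (y, z) \<in> near R (2 ^ Suc p)"
      if "y \<in> Y" "z \<in> Y" for y z
      by (rule loc_near_iff[OF x(2) xy[OF that(1)] xy[OF that(2)]]) simp
    have x_inj: "y = z" if "y \<in> Y" "z \<in> Y" "x y = x z" for y z
      using x_near_iff[OF that(1,2)] that Y_far[of y z] by auto
    have b_x: "(b, x y) \<notin> near R (2 ^ Suc p)" if y: "y \<in> Y" for y
    proof
      assume near: "(b, x y) \<in> near R (2 ^ Suc p)"
      obtain a a' where a: "h y = (a, a')" by force
      have "(a, x y) \<in> near R (2 ^ p)"
        using loc_near_iff[OF x(2), of a a' "x y" y "2 ^ p"] h[OF y] xy[OF y] a by simp
      then have "(a, b) \<in> near R (2 ^ p + 2 ^ Suc p)"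
        by (rule near_trans) (rule near[unfolded near_commute[of b]])
      moreover have "(2::nat) ^ p + 2 ^ Suc p \<le> 2 ^ (p + n + 2)"
      proof -
        have "(2::nat) ^ p + 2 ^ Suc p \<le> 2 ^ (p + 2)" by simp
        also have "\<dots> \<le> 2 ^ (p + n + 2)" by (rule power_increasing) simp_all
        finally show ?thesis .
      qed
      ultimately have "(a, b) \<in> near R (2 ^ (p + n + 2))" by (rule near_mono)
      then show False using far h(1)[OF y] a by (metis Domain.DomainI)
    qed
    have "x y \<in> X" if y: "y \<in> Y" for y
    proof -
      have "loc p {(x y, y)}"
        using loc_subset[OF loc_rank_mono[OF x(2), of p]] xy[OF y] by auto
      moreover have "loc p {(b, y)}" using y Y_X by (auto simp: X_def)
      ultimately have "loc p {(b, x y)}" using loc_trans1 loc_sym1 by blast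
      then show ?thesis using x(1)[OF y] by (simp add: X_def)
    qed
    moreover have "b \<in> X" using b loc_Id[of "{(b, b)}" p] by (simp add: X_def)
    ultimately have "insert b (x ` Y) \<subseteq> X" by blast
    moreover have "(y, z) \<notin> near R (2 ^ Suc p)"
      if yz: "y \<in> insert b (x ` Y)" "z \<in> insert b (x ` Y)" "y \<noteq> z" for y z
    proof -
      consider "y = b" "z \<in> x ` Y" | "y \<in> x ` Y" "z = b" | "y \<in> x ` Y" "z \<in> x ` Y"
        using yz by blast
      then show ?thesis
      proof cases
        case 1
        then show ?thesis using b_x by blast
      next
        case 2
        then show ?thesis unfolding near_commute[of y] using b_x by blast
      next
        case 3
        then obtain y' z' where yz': "y = x y'" "z = x z'" "y' \<in> Y" "z' \<in> Y" by blast
        then have "y' \<noteq> z'" using yz(3) by auto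
        then show ?thesis using x_near_iff[OF yz'(3,4)] Y_far[OF yz'(3,4)] yz'(1,2) by simp
      qed
    qed
    ultimately have "scattered (insert b (x ` Y))" by (simp add: scattered_def)
    moreover have "card (insert b (x ` Y)) = Suc (card Y)"
    proof -
      have "b \<notin> x ` Y" using b_x near_refl by (metis imageE)
      moreover have "card (x ` Y) = card Y" using x_inj by (intro card_image inj_onI)
      ultimately show ?thesis using YV by simp
    qed
    ultimately show False using Y_max by fastforce
  qed
qed

end

text \<open>
  Each round of the unrestricted game played on \<open>n\<close> pairs costs at most \<open>n\<close> local rounds for pulling back a
  scattered set, and three more for the distances that have to be compared.
\<close>

fun locality_rank :: "nat \<Rightarrow> nat \<Rightarrow> nat" where
  "locality_rank 0 n = 0"
| "locality_rank (Suc q) n = locality_rank q (Suc n) + n + 3"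

context labelled_structure
begin

theorem loc_imp_glob:
  assumes "finite T" "card T \<le> n" "T \<subseteq> V \<times> V" "loc (locality_rank q n) T"
  shows "glob q T"
  using assms
proof (induction q arbitrary: T n)
  case 0
  then show ?case using loc_iso by (simp add: glob_0)
next
  case (Suc q)
  let ?p = "locality_rank q (Suc n)"
  have step: "glob q (insert (b, b') T)" if "loc ?p (insert (b, b') T)" "b \<in> V" "b' \<in> V" for b b'
  proof (rule Suc.IH[OF _ _ _ that(1)])
    show "card (insert (b, b') T) \<le> Suc n"
      using Suc.prems(1,2) by (simp add: card_insert_if)
  qed (use Suc.prems that in auto)
  have rank: "loc (?p + n + 3) T" using Suc.prems(4) by simp
  have forward: "\<exists>b'\<in>V. glob q (insert (b, b') T)" if "b \<in> V" for b
    using loc_forth_everywhere[OF Suc.prems(1-3) rank that] step that by blast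
  have backward: "\<exists>b\<in>V. glob q (insert (b, b') T)" if b': "b' \<in> V" for b'
  proof -
    have "finite (T\<inverse>)" "card (T\<inverse>) \<le> n" "T\<inverse> \<subseteq> V \<times> V"
      using Suc.prems(1-3) by auto
    from loc_forth_everywhere[OF this loc_converse[OF rank] b']
    obtain b where "b \<in> V" "loc ?p (insert (b', b) (T\<inverse>))" by blast
    then show ?thesis
      using step[OF _ _ b'] loc_converse[of ?p "insert (b', b) (T\<inverse>)"] by (auto simp: converse_insert)
  qed
  show ?case
    unfolding glob_unfold using loc_iso[OF rank] forward backward by blast
qed

text \<open>
  Distance at most \<open>d\<close> is expressed with \<open>d\<close> nested quantifiers. Hence global equivalence conversely implies
  local equivalence, of a much smaller rank.
\<close>

lemma glob_near:
  assumes "glob d T" "T \<subseteq> V \<times> V" "(a, a') \<in> T" "(b, b') \<in> T" "(a, b) \<in> near R d"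
  shows "(a', b') \<in> near R d"
  using assms
proof (induction d arbitrary: T b b')
  case 0
  then show ?case using partial_iso_simps(2)[OF glob_iso] by (metis near_0)
next
  case (Suc d)
  obtain c where c: "(a, c) \<in> near R d" "(c, b) \<in> R\<^sup>=" using Suc.prems(5) by (rule near_SucE)
  then have "c \<in> V" using R_V Suc.prems(2,4) by auto
  then obtain c' where c': "c' \<in> V" "glob d (insert (c, c') T)"
    using glob_forth[OF Suc.prems(1)] by blast
  have "(a', c') \<in> near R d"
    using Suc.IH[OF c'(2), of c c'] Suc.prems(2,3) c(1) c'(1) \<open>c \<in> V\<close> by simp
  moreover have "(c', b') \<in> R\<^sup>="
    using partial_iso_simps(2,3)[OF glob_iso[OF c'(2)], of c c' b b'] Suc.prems(4) c(2) by auto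
  ultimately show ?case by (rule near_SucI)
qed

lemma glob_same_distances:
  assumes "glob d T" "T \<subseteq> V \<times> V"
  shows "same_distances R d T"
  unfolding same_distances_def
proof (intro allI impI)
  fix a a' b b' e assume ab: "(a, a') \<in> T" "(b, b') \<in> T" and "e \<le> d"
  then have e: "glob e T" "glob e (T\<inverse>)"
    using glob_rank_mono[OF assms(1)] glob_converse by blast+
  have "T\<inverse> \<subseteq> V \<times> V" using assms(2) by auto
  with ab show "(a, b) \<in> near R e \<longleftrightarrow> (a', b') \<in> near R e"
    using glob_near[OF e(1) assms(2)] glob_near[OF e(2)] by blast
qed

lemma glob_imp_loc:
  assumes "glob (q + 2 ^ q) T" "T \<subseteq> V \<times> V"
  shows "loc q T"
  using assms
proof (induction q arbitrary: T)
  case 0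
  then show ?case
    using glob_iso[OF 0(1)] glob_same_distances[OF 0] by (simp add: loc_0)
next
  case (Suc q)
  have down: "glob (Suc (q + 2 ^ q)) T"
    using glob_rank_mono[OF Suc.prems(1)] by simp
  have "same_distances R (2 ^ Suc q) T"
    using glob_same_distances[OF glob_rank_mono[OF Suc.prems(1)] Suc.prems(2)] by simp
  moreover have "\<exists>b'\<in>V. loc q (insert (b, b') T)" if "b \<in> V" for b
    using glob_forth[OF down that] Suc.IH Suc.prems(2) that by (metis insert_subset mem_Sigma_iff)
  moreover have "\<exists>b\<in>V. loc q (insert (b, b') T)" if "b' \<in> V" for b'
    using glob_back[OF down that] Suc.IH Suc.prems(2) that by (metis insert_subset mem_Sigma_iff)
  ultimately show ?case unfolding loc_unfold using glob_iso[OF down] by blast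
qed

text \<open>
  Global types of the entries are weakened to local types, these are composed, and the local type of the
  pair determines its global type.
\<close>

theorem glob_far_pair:
  fixes q
  defines "p \<equiv> locality_rank q 2"
  assumes V: "u \<in> V" "u' \<in> V" "v \<in> V" "v' \<in> V"
    and glob: "glob (p + 2 ^ p) {(u, u')}" "glob (p + 2 ^ p) {(v, v')}"
    and far: "(u, v) \<notin> near R (2 ^ p)" "(u', v') \<notin> near R (2 ^ p)"
  shows "glob q {(u, u'), (v, v')}"
proof (rule loc_imp_glob)
  show "loc (locality_rank q 2) {(u, u'), (v, v')}"
    using loc_compose[of p "{(u, u')}" "{(v, v')}"] glob_imp_loc[OF glob(1)] glob_imp_loc[OF glob(2)]
      V far by (simp add: p_def insert_commute)
qed (use V in \<open>auto simp: card_insert_if\<close>)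

end

section \<open>Counting types\<close>

text \<open>
  Types are counted by colouring: a bounded number of colours such that equal colours imply equivalence. This avoids
  types as objects, which would live on different levels of the power set hierarchy.
\<close>

lemma colouring_of_finite_image:
  assumes "finite C" "f ` X \<subseteq> C"
  obtains \<tau> :: "'b \<Rightarrow> nat"
  where "\<And>x. x \<in> X \<Longrightarrow> \<tau> x < card C" "\<And>x y. x \<in> X \<Longrightarrow> y \<in> X \<Longrightarrow> \<tau> x = \<tau> y \<Longrightarrow> f x = f y"
proof -
  obtain h where h: "bij_betw h C {0..<card C}"
    using ex_bij_betw_finite_nat[OF assms(1)] by blast
  show thesis
  proof (rule that[of "h \<circ> f"])
    fix x assume "x \<in> X"
    then show "(h \<circ> f) x < card C" using bij_betw_apply[OF h, of "f x"] assms(2) by auto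
  next
    fix x y assume "x \<in> X" "y \<in> X" "(h \<circ> f) x = (h \<circ> f) y"
    then show "f x = f y"
      using assms(2) inj_onD[OF bij_betw_imp_inj_on[OF h], of "f x" "f y"] by auto
  qed
qed

text \<open>
  For tuples of length \<open>n\<close> with entries from \<open>k\<close> labels: the choices of the labels, of the distances up to \<open>2 ^ q\<close>, and of
  the relation \<open>E\<close>.
\<close>

definition atom_bound :: "nat \<Rightarrow> nat \<Rightarrow> nat \<Rightarrow> nat" where
  "atom_bound k q n = k ^ n * (2 ^ (n * n * Suc (2 ^ q)) * 2 ^ (n * n))"

text \<open>
  A local type of rank \<open>Suc q\<close> consists of an atomic type and of the set of rank-\<open>q\<close> types of the extensions
  by a near element.
\<close>

fun type_bound :: "nat \<Rightarrow> nat \<Rightarrow> nat \<Rightarrow> nat" where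
  "type_bound k 0 n = atom_bound k 0 n"
| "type_bound k (Suc q) n = atom_bound k (Suc q) n * 2 ^ type_bound k q (Suc n)"

context labelled_structure
begin

definition ball :: "nat \<Rightarrow> 'a set \<Rightarrow> 'a set" where
  "ball d S = {b \<in> V. \<exists>a\<in>S. (a, b) \<in> near R d}"

definition tuples :: "nat \<Rightarrow> 'a set \<Rightarrow> 'a list set" where
  "tuples n S = {as. length as = n \<and> set as \<subseteq> S}"

definition atomic_type ::
  "nat \<Rightarrow> 'a list \<Rightarrow> 'l list \<times> ((nat \<times> nat) \<times> nat) set \<times> (nat \<times> nat) set" where
  "atomic_type d as = (map lab as,
     {((i, j), e). i < length as \<and> j < length as \<and> e \<le> d \<and> (as ! i, as ! j) \<in> near R e},
     {(i, j). i < length as \<and> j < length as \<and> (as ! i, as ! j) \<in> E})"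

text \<open>
  Equality and \<open>R\<close> need no separate entry in the atomic type, since they are distance \<open>0\<close> and, for an
  irreflexive \<open>R\<close>, distance exactly \<open>1\<close>.
\<close>

lemma atomic_type_eq:
  assumes "atomic_type d as = atomic_type d bs" "length as = n" "length bs = n" "0 < d"
  shows "partial_iso R E lab (set (zip as bs)) \<and> same_distances R d (set (zip as bs))"
proof -
  have labs: "map lab as = map lab bs" using assms(1) by (simp add: atomic_type_def)
  have near: "(as ! i, as ! j) \<in> near R e \<longleftrightarrow> (bs ! i, bs ! j) \<in> near R e"
    if "i < n" "j < n" "e \<le> d" for i j e
    using assms(1-3) that unfolding atomic_type_def prod.inject set_eq_iff by fastforce
  have E: "(as ! i, as ! j) \<in> E \<longleftrightarrow> (bs ! i, bs ! j) \<in> E" if "i < n" "j < n" for i j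
    using assms(1-3) that unfolding atomic_type_def prod.inject set_eq_iff by fastforce
  have dist: "same_distances R d (set (zip as bs))"
    unfolding same_distances_def using near assms(2,3) by (auto simp: set_zip)
  have "partial_iso R E lab (set (zip as bs))"
  proof (rule partial_isoI)
    fix a a' assume "(a, a') \<in> set (zip as bs)"
    then show "lab a = lab a'"
      using labs assms(2,3) by (auto simp: set_zip) (metis nth_map)
  next
    fix a a' b b' assume ab: "(a, a') \<in> set (zip as bs)" "(b, b') \<in> set (zip as bs)"
    then have "(a, b) \<in> E \<longleftrightarrow> (a', b') \<in> E" using E assms(2,3) by (auto simp: set_zip)
    moreover have "a = b \<longleftrightarrow> a' = b'"
      using same_distancesD[OF dist ab, of 0] by simp
    moreover have "(a, b) \<in> R\<^sup>= \<longleftrightarrow> (a', b') \<in> R\<^sup>="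
      using same_distancesD[OF dist ab, of "Suc 0"] assms(4) by simp
    ultimately show "(a = b \<longleftrightarrow> a' = b') \<and> ((a, b) \<in> R \<longleftrightarrow> (a', b') \<in> R) \<and> ((a, b) \<in> E \<longleftrightarrow> (a', b') \<in> E)"
      using R_irrefl by (auto simp: irrefl_def)
  qed
  then show ?thesis using dist by blast
qed

lemma atomic_type_bound:
  assumes "card (lab ` S) \<le> k" "S \<subseteq> V"
  obtains C where "finite C" "card C \<le> atom_bound k q n" "atomic_type (2 ^ q) ` tuples n S \<subseteq> C"
proof
  let ?L = "{ls. set ls \<subseteq> lab ` S \<and> length ls = n}"
    and ?D = "Pow (({..<n} \<times> {..<n}) \<times> {..(2::nat) ^ q})" and ?E = "Pow ({..<n} \<times> {..<n})"
  have fin: "finite (lab ` S)" using assms(2) V_finite finite_subset by blast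
  show "finite (?L \<times> ?D \<times> ?E)" using finite_lists_length_eq[OF fin] by (intro finite_SigmaI) auto
  have "card (?L \<times> ?D \<times> ?E) = card (lab ` S) ^ n * (2 ^ (n * n * Suc (2 ^ q)) * 2 ^ (n * n))"
    by (simp only: card_cartesian_product card_lists_length_eq[OF fin] card_Pow
      finite_cartesian_product finite_lessThan finite_atMost card_lessThan card_atMost)
  then show "card (?L \<times> ?D \<times> ?E) \<le> atom_bound k q n"
    unfolding atom_bound_def using power_mono[OF assms(1), of n] by (simp only: mult_le_mono1 zero_le)
  show "atomic_type (2 ^ q) ` tuples n S \<subseteq> ?L \<times> ?D \<times> ?E"
    by (auto simp: atomic_type_def tuples_def subset_iff)
qed

lemma ball_superset: "S \<subseteq> V \<Longrightarrow> S \<subseteq> ball d S"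
  unfolding ball_def using near_refl by fast

lemma ball_ball: "ball d (ball e S) \<subseteq> ball (e + d) S"
  unfolding ball_def using near_trans[of _ _ R e _ d] by blast

text \<open>
  The radii of the game sum to \<open>2 ^ (q - 1) + \<dots> + 1 < 2 ^ q\<close>, so all elements pebbled during the game on a tuple from
  \<open>S\<close> lie in the ball of radius \<open>2 ^ q\<close> around \<open>S\<close>. Only the labels in this ball are counted.
\<close>

theorem loc_colouring:
  assumes "S \<subseteq> V" "card (lab ` ball (2 ^ q) S) \<le> k"
  shows "\<exists>\<tau>::'a list \<Rightarrow> nat. (\<forall>as\<in>tuples n S. \<tau> as < type_bound k q n) \<and>
    (\<forall>as\<in>tuples n S. \<forall>bs\<in>tuples n S. \<tau> as = \<tau> bs \<longrightarrow> loc q (set (zip as bs)))"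
  using assms
proof (induction q arbitrary: n S)
  case 0
  have "card (lab ` S) \<le> k"
    using card_mono[OF _ image_mono[OF ball_superset[OF 0(1)]], of lab 1] 0(2) V_finite
    by (fastforce simp: ball_def)
  then obtain C where C: "finite C" "card C \<le> atom_bound k 0 n" "atomic_type (2 ^ 0) ` tuples n S \<subseteq> C"
    using atomic_type_bound 0(1) by metis
  obtain \<tau> :: "'a list \<Rightarrow> nat" where \<tau>: "\<And>as. as \<in> tuples n S \<Longrightarrow> \<tau> as < card C"
    "\<And>as bs. as \<in> tuples n S \<Longrightarrow> bs \<in> tuples n S \<Longrightarrow> \<tau> as = \<tau> bs \<Longrightarrow> atomic_type (2 ^ 0) as = atomic_type (2 ^ 0) bs"
    using colouring_of_finite_image[OF C(1,3)] by metis
  show ?case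
  proof (intro exI[of _ \<tau>] conjI ballI impI)
    fix as assume "as \<in> tuples n S"
    then show "\<tau> as < type_bound k 0 n" using \<tau>(1) C(2) by fastforce
  next
    fix as bs assume ab: "as \<in> tuples n S" "bs \<in> tuples n S" "\<tau> as = \<tau> bs"
    then show "loc 0 (set (zip as bs))"
      unfolding loc_0 using atomic_type_eq[OF \<tau>(2)[OF ab]] by (simp add: tuples_def)
  qed
next
  case (Suc q)
  let ?S = "ball (2 ^ q) S"
  have SV: "?S \<subseteq> V" by (auto simp: ball_def)
  have sub: "S \<subseteq> ?S" using ball_superset[OF Suc.prems(1)] .
  have balls: "ball (2 ^ q) ?S \<subseteq> ball (2 ^ Suc q) S" "S \<subseteq> ball (2 ^ Suc q) S"
    using ball_ball[of "2 ^ q" "2 ^ q" S] ball_superset[OF Suc.prems(1)] by (simp_all add: mult_2)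
  have fin: "finite (lab ` ball (2 ^ Suc q) S)" using V_finite by (simp add: ball_def)
  have "card (lab ` ball (2 ^ q) ?S) \<le> k"
    using card_mono[OF fin image_mono[OF balls(1)]] Suc.prems(2) by simp
  from Suc.IH[OF SV this, of "Suc n"]
  obtain \<tau>' :: "'a list \<Rightarrow> nat" where \<tau>': "\<And>as. as \<in> tuples (Suc n) ?S \<Longrightarrow> \<tau>' as < type_bound k q (Suc n)"
    "\<And>as bs. as \<in> tuples (Suc n) ?S \<Longrightarrow> bs \<in> tuples (Suc n) ?S \<Longrightarrow> \<tau>' as = \<tau>' bs \<Longrightarrow> loc q (set (zip as bs))"
    by blast
  have "card (lab ` S) \<le> k"
    using card_mono[OF fin image_mono[OF balls(2)]] Suc.prems(2) by simp
  then obtain C where C: "finite C" "card C \<le> atom_bound k (Suc q) n"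
    "atomic_type (2 ^ Suc q) ` tuples n S \<subseteq> C"
    using atomic_type_bound Suc.prems(1) by metis
  define f where "f as = (atomic_type (2 ^ Suc q) as, (\<lambda>b. \<tau>' (b # as)) ` ball (2 ^ q) (set as))" for as
  have ext: "b # as \<in> tuples (Suc n) ?S" if "as \<in> tuples n S" "b \<in> ball (2 ^ q) (set as)" for as b
    using that sub by (auto simp: tuples_def ball_def)
  let ?C = "C \<times> Pow {..<type_bound k q (Suc n)}"
  have "f ` tuples n S \<subseteq> ?C"
    using C(3) \<tau>'(1) ext by (auto simp: f_def)
  then obtain \<tau> :: "'a list \<Rightarrow> nat" where \<tau>: "\<And>as. as \<in> tuples n S \<Longrightarrow> \<tau> as < card ?C"
    "\<And>as bs. as \<in> tuples n S \<Longrightarrow> bs \<in> tuples n S \<Longrightarrow> \<tau> as = \<tau> bs \<Longrightarrow> f as = f bs"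
    using colouring_of_finite_image[of ?C f "tuples n S"] C(1) by (metis finite_Pow_iff finite_SigmaI finite_lessThan)
  have card_C: "card ?C \<le> type_bound k (Suc q) n"
    using C(1,2) by (simp add: card_cartesian_product card_Pow)
  show ?case
  proof (intro exI[of _ \<tau>] conjI ballI impI)
    fix as assume "as \<in> tuples n S"
    then show "\<tau> as < type_bound k (Suc q) n" using \<tau>(1) card_C by fastforce
  next
    have forward: "\<exists>b'\<in>V. loc q (insert (b, b') (set (zip as bs)))"
      if ab: "as \<in> tuples n S" "bs \<in> tuples n S" "f as = f bs" and b: "b \<in> ball (2 ^ q) (set as)" for as bs b
    proof -
      have "\<tau>' (b # as) \<in> (\<lambda>b. \<tau>' (b # bs)) ` ball (2 ^ q) (set bs)"
        using ab(3) b unfolding f_def prod.inject by blast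
      then obtain b' where b': "b' \<in> ball (2 ^ q) (set bs)" "\<tau>' (b # as) = \<tau>' (b' # bs)" by blast
      then show ?thesis
        using \<tau>'(2)[OF ext[OF ab(1) b] ext[OF ab(2) b'(1)] b'(2)] by (auto simp: ball_def)
    qed
    fix as bs assume ab: "as \<in> tuples n S" "bs \<in> tuples n S" "\<tau> as = \<tau> bs"
    note f = \<tau>(2)[OF ab]
    have len: "length as = n" "length bs = n" using ab by (auto simp: tuples_def)
    have dom: "Domain (set (zip as bs)) = set as" "Range (set (zip as bs)) = set bs"
      using len by (auto simp: Domain_fst Range_snd simp flip: set_map)
    have "partial_iso R E lab (set (zip as bs)) \<and> same_distances R (2 ^ Suc q) (set (zip as bs))"
      using f len by (intro atomic_type_eq) (auto simp: f_def)
    moreover have "\<exists>b\<in>V. loc q (insert (b, b') (set (zip as bs)))" if b: "b' \<in> ball (2 ^ q) (set bs)" for b'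
    proof -
      obtain b where "b \<in> V" "loc q (insert (b', b) (set (zip bs as)))"
        using forward[OF ab(2,1) f[symmetric] b] by blast
      moreover have "(insert (b', b) (set (zip bs as)))\<inverse> = insert (b, b') (set (zip as bs))"
        using len by (auto simp: set_zip converse_insert)
      ultimately show ?thesis using loc_converse by metis
    qed
    ultimately show "loc (Suc q) (set (zip as bs))"
      unfolding loc_unfold dom using forward[OF ab(1,2) f] unfolding ball_def by blast
  qed
qed

corollary glob_colouring:
  fixes q
  defines "p \<equiv> locality_rank q 1"
  assumes "S \<subseteq> V" "card (lab ` ball (2 ^ p) S) \<le> k"
  obtains \<tau> :: "'a \<Rightarrow> nat"
  where "\<And>x. x \<in> S \<Longrightarrow> \<tau> x < type_bound k p 1"
    "\<And>x y. x \<in> S \<Longrightarrow> y \<in> S \<Longrightarrow> \<tau> x = \<tau> y \<Longrightarrow> glob q {(x, y)}"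
proof -
  obtain \<tau> :: "'a list \<Rightarrow> nat" where \<tau>: "\<And>as. as \<in> tuples 1 S \<Longrightarrow> \<tau> as < type_bound k p 1"
    "\<And>as bs. as \<in> tuples 1 S \<Longrightarrow> bs \<in> tuples 1 S \<Longrightarrow> \<tau> as = \<tau> bs \<Longrightarrow> loc p (set (zip as bs))"
    using loc_colouring[OF assms(2,3), of 1] by blast
  show thesis
  proof (rule that[of "\<lambda>x. \<tau> [x]"])
    fix x assume "x \<in> S"
    then show "\<tau> [x] < type_bound k p 1" by (intro \<tau>(1)) (simp add: tuples_def)
  next
    fix x y assume xy: "x \<in> S" "y \<in> S" "\<tau> [x] = \<tau> [y]"
    then have "loc p {(x, y)}" using \<tau>(2)[of "[x]" "[y]"] by (simp add: tuples_def)
    then show "glob q {(x, y)}"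
      using xy(1,2) assms(2) unfolding p_def by (intro loc_imp_glob[of _ 1]) auto
  qed
qed

end

section \<open>First-order formulas\<close>

lemma global_equiv_Suc:
  "global_equiv V R E lab (Suc q) T \<longleftrightarrow> partial_iso R E lab T \<and>
     (\<forall>b\<in>V. \<exists>b'\<in>V. global_equiv V R E lab q (insert (b, b') T)) \<and>
     (\<forall>b'\<in>V. \<exists>b\<in>V. global_equiv V R E lab q (insert (b, b') T))"
  by (simp add: global_equiv_def)

text \<open>
  The two structures share their vertices and \<open>E\<close>. The assumption holds if the second one is definable without quantifiers
  in the first.
\<close>

lemma global_equiv_transfer:
  assumes "\<And>T. T \<subseteq> V \<times> V \<Longrightarrow> partial_iso R E lab T \<Longrightarrow> partial_iso R' E lab' T"
    and "T \<subseteq> V \<times> V" "global_equiv V R E lab q T"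
  shows "global_equiv V R' E lab' q T"
  using assms(2,3)
proof (induction q arbitrary: T)
  case 0
  then show ?case using assms(1) by (simp add: global_equiv_def)
next
  case (Suc q)
  have ext: "global_equiv V R' E lab' q (insert (b, b') T)"
    if "b \<in> V" "b' \<in> V" "global_equiv V R E lab q (insert (b, b') T)" for b b'
    using Suc.IH[OF _ that(3)] that(1,2) Suc.prems(1) by blast
  note G = Suc.prems(2)[unfolded global_equiv_Suc]
  have "\<exists>b'\<in>V. global_equiv V R' E lab' q (insert (b, b') T)" if b: "b \<in> V" for b
  proof -
    obtain b' where "b' \<in> V" "global_equiv V R E lab q (insert (b, b') T)" using G b by blast
    then show ?thesis using ext[OF b] by blast
  qed
  moreover have "\<exists>b\<in>V. global_equiv V R' E lab' q (insert (b, b') T)" if b': "b' \<in> V" for b'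
  proof -
    obtain b where "b \<in> V" "global_equiv V R E lab q (insert (b, b') T)" using G b' by blast
    then show ?thesis using ext[OF _ b'] by blast
  qed
  ultimately show ?case unfolding global_equiv_Suc using assms(1)[OF Suc.prems(1)] G by blast
qed

fun quantifier_rank :: "fo \<Rightarrow> nat" where
  "quantifier_rank (Neg \<phi>) = quantifier_rank \<phi>"
| "quantifier_rank (Conj \<phi> \<psi>) = max (quantifier_rank \<phi>) (quantifier_rank \<psi>)"
| "quantifier_rank (Ex x \<phi>) = Suc (quantifier_rank \<phi>)"
| "quantifier_rank _ = 0"

fun colours :: "fo \<Rightarrow> nat set" where
  "colours (Col i x) = {i}"
| "colours (Neg \<phi>) = colours \<phi>"
| "colours (Conj \<phi> \<psi>) = colours \<phi> \<union> colours \<psi>"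
| "colours (Ex x \<phi>) = colours \<phi>"
| "colours _ = {}"

lemma finite_colours: "finite (colours \<phi>)"
  by (induction \<phi>) auto

lemma (in labelled_structure) sat_glob:
  assumes "verts G = V" and "E = {(u, v). {u, v} \<in> edges G}"
    and "\<And>i u v. i \<in> colours \<phi> \<Longrightarrow> lab u = lab v \<Longrightarrow> u \<in> P i \<Longrightarrow> v \<in> P i"
    and "glob (quantifier_rank \<phi>) T"
    and "\<And>x. x \<in> free_vars \<phi> \<Longrightarrow> (\<sigma> x, \<sigma>' x) \<in> T"
  shows "sat G P \<sigma> \<phi> \<longleftrightarrow> sat G P \<sigma>' \<phi>"
  using assms(3-)
proof (induction \<phi> arbitrary: \<sigma> \<sigma>' T)
  case (Eq x y)
  then show ?case using partial_iso_simps(2)[OF glob_iso[OF Eq(2)]] by simp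
next
  case (Adj x y)
  then show ?case using partial_iso_simps(4)[OF glob_iso[OF Adj(2)], of "\<sigma> x" "\<sigma>' x" "\<sigma> y" "\<sigma>' y"] assms(2) by simp
next
  case (Col i x)
  have "lab (\<sigma> x) = lab (\<sigma>' x)"
    using partial_iso_simps(1)[OF glob_iso[OF Col(2)]] Col(3) by simp
  then show ?case using Col(1)[of i "\<sigma> x" "\<sigma>' x"] Col(1)[of i "\<sigma>' x" "\<sigma> x"] by auto
next
  case (Neg \<phi>)
  have "sat G P \<sigma> \<phi> \<longleftrightarrow> sat G P \<sigma>' \<phi>"
  proof (rule Neg.IH)
    show "v \<in> P i" if "i \<in> colours \<phi>" "lab u = lab v" "u \<in> P i" for i u v
      using Neg.prems(1)[of i u v] that by simp
  qed (use Neg.prems(2,3) in simp_all)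
  then show ?case by simp
next
  case (Conj \<phi> \<psi>)
  have rank: "glob (quantifier_rank \<phi>) T" "glob (quantifier_rank \<psi>) T"
    using glob_rank_mono[OF Conj.prems(2)] by simp_all
  have "sat G P \<sigma> \<phi> \<longleftrightarrow> sat G P \<sigma>' \<phi>"
  proof (rule Conj.IH(1)[OF _ rank(1)])
    show "v \<in> P i" if "i \<in> colours \<phi>" "lab u = lab v" "u \<in> P i" for i u v
      using Conj.prems(1)[of i u v] that by simp
  qed (use Conj.prems(3) in simp)
  moreover have "sat G P \<sigma> \<psi> \<longleftrightarrow> sat G P \<sigma>' \<psi>"
  proof (rule Conj.IH(2)[OF _ rank(2)])
    show "v \<in> P i" if "i \<in> colours \<psi>" "lab u = lab v" "u \<in> P i" for i u v
      using Conj.prems(1)[of i u v] that by simp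
  qed (use Conj.prems(3) in simp)
  ultimately show ?case by simp
next
  case (Ex x \<phi>)
  have rank: "glob (Suc (quantifier_rank \<phi>)) T" using Ex.prems(2) by simp
  have IH: "sat G P (\<sigma>(x := b)) \<phi> \<longleftrightarrow> sat G P (\<sigma>'(x := b')) \<phi>"
    if "glob (quantifier_rank \<phi>) (insert (b, b') T)" for b b'
  proof (rule Ex.IH[OF _ that])
    show "v \<in> P i" if "i \<in> colours \<phi>" "lab u = lab v" "u \<in> P i" for i u v
      using Ex.prems(1)[of i u v] that by simp
    show "((\<sigma>(x := b)) z, (\<sigma>'(x := b')) z) \<in> insert (b, b') T" if "z \<in> free_vars \<phi>" for z
      using Ex.prems(3)[of z] that by simp
  qed
  show ?case
  proof
    assume "sat G P \<sigma> (Ex x \<phi>)"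
    then obtain b where b: "b \<in> V" "sat G P (\<sigma>(x := b)) \<phi>" using assms(1) by auto
    then obtain b' where "b' \<in> V" "glob (quantifier_rank \<phi>) (insert (b, b') T)"
      using glob_forth[OF rank] by blast
    then show "sat G P \<sigma>' (Ex x \<phi>)" using IH b(2) assms(1) by auto
  next
    assume "sat G P \<sigma>' (Ex x \<phi>)"
    then obtain b' where b': "b' \<in> V" "sat G P (\<sigma>'(x := b')) \<phi>" using assms(1) by auto
    then obtain b where "b \<in> V" "glob (quantifier_rank \<phi>) (insert (b, b') T)"
      using glob_back[OF rank] by blast
    then show "sat G P \<sigma> (Ex x \<phi>)" using IH b'(2) assms(1) by auto
  qed
qed

section \<open>Construction sequences with prescribed partitions and resolved pairs\<close>

text \<open>
  A state in which the pairs in \<open>R\<close> are resolved, and correctly so for the edge set \<open>E\<close>.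
\<close>

definition graph_state :: "'a set \<Rightarrow> 'a set set \<Rightarrow> 'a set set \<Rightarrow> 'a set set \<Rightarrow> 'a cstate" where
  "graph_state V E P R = \<lparr>parts = P, pos = R \<inter> E, neg = R - E, unres = nsets V 2 - R\<rparr>"

definition narrow :: "'a set \<Rightarrow> nat \<Rightarrow> nat \<Rightarrow> 'a cstate \<Rightarrow> bool" where
  "narrow V r k s \<longleftrightarrow> (\<forall>v\<in>V. card (reachable_parts V r s v) \<le> k)"

definition narrow_step :: "'a set \<Rightarrow> nat \<Rightarrow> nat \<Rightarrow> 'a cstate \<Rightarrow> 'a cstate \<Rightarrow> bool" where
  "narrow_step V r k s s' \<longleftrightarrow> cstep s s' \<and> narrow V r k s'"

lemma reachable_parts_graph_state:
  "reachable_parts V r (graph_state V E P R) v =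
    {A \<in> P. \<exists>w\<in>A. reachable_within \<lparr>verts = V, edges = R\<rparr> r v w}"
proof -
  have "R \<inter> E \<union> (R - E) = R" by blast
  then show ?thesis by (simp add: reachable_parts_def graph_state_def)
qed

lemma reachable_within_mono:
  "reachable_within \<lparr>verts = V, edges = R\<rparr> r v w \<Longrightarrow> R \<subseteq> R' \<Longrightarrow>
    reachable_within \<lparr>verts = V, edges = R'\<rparr> r v w"
  unfolding reachable_within_def path_def
  by (elim exE conjE, rule exI) (auto intro: successively_mono)

text \<open>
  Thanks to this monotonicity, the width needs to be bounded only where a partition is at its finest
  relative to the pairs resolved: after resolving and before merging.
\<close>

lemma narrow_coarsen:
  assumes P: "refines V P Q" "finite P" and R: "R \<subseteq> R'" and narrow: "narrow V r k (graph_state V E P R')"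
  shows "narrow V r k (graph_state V E Q R)"
  unfolding narrow_def
proof
  fix v assume v: "v \<in> V"
  let ?X = "reachable_parts V r (graph_state V E Q R) v"
  let ?Y = "reachable_parts V r (graph_state V E P R') v"
  have part: "partition_on V P" "partition_on V Q" "\<And>X. X \<in> P \<Longrightarrow> \<exists>Y\<in>Q. X \<subseteq> Y"
    using P(1) by (auto simp: refines_def)
  have "\<forall>C\<in>?X. \<exists>A\<in>?Y. A \<subseteq> C"
  proof
    fix C assume "C \<in> ?X"
    then obtain w where w: "C \<in> Q" "w \<in> C" "reachable_within \<lparr>verts = V, edges = R\<rparr> r v w"
      by (auto simp: reachable_parts_graph_state)
    then have "w \<in> V" using partition_onD1[OF part(2)] by blast
    then obtain A where A: "A \<in> P" "w \<in> A" using partition_onD1[OF part(1)] by blast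
    then obtain C' where C': "C' \<in> Q" "A \<subseteq> C'" using part(3) by blast
    then have "C' = C" using partition_onD2[OF part(2)] w(1,2) A(2) by (auto simp: disjoint_def)
    then show "\<exists>A\<in>?Y. A \<subseteq> C"
      using A C' reachable_within_mono[OF w(3) R] by (auto simp: reachable_parts_graph_state)
  qed
  then obtain h where h: "\<And>C. C \<in> ?X \<Longrightarrow> h C \<in> ?Y" "\<And>C. C \<in> ?X \<Longrightarrow> h C \<subseteq> C" by metis
  have "inj_on h ?X"
  proof (rule inj_onI)
    fix C C' assume C: "C \<in> ?X" "C' \<in> ?X" "h C = h C'"
    then obtain w where "w \<in> h C" using h(1)[OF C(1)] by (auto simp: reachable_parts_graph_state)
    then have "w \<in> C \<inter> C'" using h(2) C by blast
    moreover have "C \<in> Q" "C' \<in> Q" using C(1,2) by (auto simp: reachable_parts_graph_state)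
    ultimately show "C = C'" using partition_onD2[OF part(2)] by (auto simp: disjoint_def)
  qed
  moreover have "finite ?Y" using P(2) by (simp add: reachable_parts_graph_state)
  ultimately have "card ?X \<le> card ?Y" using h(1) by (intro card_inj_on_le[of h]) auto
  then show "card ?X \<le> k" using narrow v by (fastforce simp: narrow_def)
qed

text \<open>
  Pairs of parts are resolved one after the other; the uniformity assumption decides whether positively or
  negatively.
\<close>

lemma resolve_pairs:
  assumes P: "partition_on V P" "finite P"
    and F: "finite F" "F \<subseteq> P \<times> P"
    and uniform: "\<And>A B. (A, B) \<in> F \<Longrightarrow>
      pairs_between A B \<inter> nsets V 2 - R \<subseteq> E \<or> (pairs_between A B \<inter> nsets V 2 - R) \<inter> E = {}"
    and narrow: "narrow V r k (graph_state V E P (R \<union> (\<Union>(A, B)\<in>F. pairs_between A B) \<inter> nsets V 2))"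
  shows "(narrow_step V r k)\<^sup>*\<^sup>* (graph_state V E P R)
    (graph_state V E P (R \<union> (\<Union>(A, B)\<in>F. pairs_between A B) \<inter> nsets V 2))"
  using F uniform narrow
proof (induction F rule: finite_induct)
  case empty
  then show ?case by simp
next
  case (insert f F)
  obtain A B where f: "f = (A, B)" by force
  let ?R1 = "R \<union> (\<Union>(A, B)\<in>F. pairs_between A B) \<inter> nsets V 2"
    and ?R2 = "R \<union> (\<Union>(A, B)\<in>insert f F. pairs_between A B) \<inter> nsets V 2"
  have R2: "?R2 = ?R1 \<union> pairs_between A B \<inter> nsets V 2" using f by auto
  have "narrow V r k (graph_state V E P ?R1)"
    by (rule narrow_coarsen[OF refines_refl[OF P(1)] P(2) _ insert.prems(3)]) auto
  then have "(narrow_step V r k)\<^sup>*\<^sup>* (graph_state V E P R) (graph_state V E P ?R1)"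
    using insert.IH insert.prems(1,2) by auto
  moreover have "cstep (graph_state V E P ?R1) (graph_state V E P ?R2)"
  proof -
    have AB: "A \<in> parts (graph_state V E P ?R1)" "B \<in> parts (graph_state V E P ?R1)"
      using insert.prems(1) f by (auto simp: graph_state_def)
    have "pairs_between A B \<inter> nsets V 2 - R \<subseteq> E \<or> (pairs_between A B \<inter> nsets V 2 - R) \<inter> E = {}"
      using insert.prems(2) f by blast
    then consider "pairs_between A B \<inter> nsets V 2 - ?R1 \<subseteq> E"
      | "(pairs_between A B \<inter> nsets V 2 - ?R1) \<inter> E = {}" by blast
    then show ?thesis
    proof cases
      case 1
      have "?R2 \<inter> E = ?R1 \<inter> E \<union> (nsets V 2 - ?R1) \<inter> pairs_between A B"
        "?R2 - E = ?R1 - E" "nsets V 2 - ?R2 = (nsets V 2 - ?R1) - pairs_between A B"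
        unfolding R2 using 1 by blast+
      then have "graph_state V E P ?R2 = (graph_state V E P ?R1)
          \<lparr>pos := pos (graph_state V E P ?R1) \<union> (unres (graph_state V E P ?R1) \<inter> pairs_between A B),
           unres := unres (graph_state V E P ?R1) - pairs_between A B\<rparr>"
        unfolding graph_state_def by simp
      then show ?thesis using cstep.resolve_pos[OF AB] by simp
    next
      case 2
      have "?R2 - E = (?R1 - E) \<union> (nsets V 2 - ?R1) \<inter> pairs_between A B"
        "?R2 \<inter> E = ?R1 \<inter> E" "nsets V 2 - ?R2 = (nsets V 2 - ?R1) - pairs_between A B"
        unfolding R2 using 2 by blast+
      then have "graph_state V E P ?R2 = (graph_state V E P ?R1)
          \<lparr>neg := neg (graph_state V E P ?R1) \<union> (unres (graph_state V E P ?R1) \<inter> pairs_between A B),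
           unres := unres (graph_state V E P ?R1) - pairs_between A B\<rparr>"
        unfolding graph_state_def by simp
      then show ?thesis using cstep.resolve_neg[OF AB] by simp
    qed
  qed
  ultimately show ?case
    using insert.prems(3) by (meson narrow_step_def rtranclp.rtrancl_into_rtrancl)
qed

lemma partition_on_merge:
  assumes "partition_on V P" "A \<in> P" "B \<in> P"
  shows "partition_on V (insert (A \<union> B) (P - {A, B}))"
proof (rule partition_onI)
  show "\<Union> (insert (A \<union> B) (P - {A, B})) = V"
    using partition_onD1[OF assms(1)] assms(2,3) by auto
next
  fix p q assume "p \<in> insert (A \<union> B) (P - {A, B})" "q \<in> insert (A \<union> B) (P - {A, B})" "p \<noteq> q"
  then show "disjnt p q"
    using partition_onD2[OF assms(1)] assms(2,3) unfolding disjoint_def disjnt_def by blast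
next
  show "{} \<notin> insert (A \<union> B) (P - {A, B})" using partition_onD3[OF assms(1)] assms(2,3) by auto
qed

lemma merge_parts:
  assumes "refines V P Q" "finite P" "narrow V r k (graph_state V E P R)"
  shows "(narrow_step V r k)\<^sup>*\<^sup>* (graph_state V E P R) (graph_state V E Q R)"
  using assms
proof (induction "card P" arbitrary: P rule: less_induct)
  case less
  have part: "partition_on V P" "partition_on V Q" and ref: "\<And>X. X \<in> P \<Longrightarrow> \<exists>Y\<in>Q. X \<subseteq> Y"
    using less.prems(1) by (auto simp: refines_def)
  show ?case
  proof (cases "\<exists>A\<in>P. \<exists>B\<in>P. \<exists>C\<in>Q. A \<noteq> B \<and> A \<subseteq> C \<and> B \<subseteq> C")
    case True
    then obtain A B C where AB: "A \<in> P" "B \<in> P" "A \<noteq> B" and C: "C \<in> Q" "A \<subseteq> C" "B \<subseteq> C" by blast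
    let ?P = "insert (A \<union> B) (P - {A, B})"
    have P': "partition_on V ?P" by (rule partition_on_merge[OF part(1) AB(1,2)])
    have ref1: "refines V ?P Q"
      using P' part(2) ref C by (auto simp: refines_def)
    have ref2: "refines V P ?P"
      using P' part(1) by (auto simp: refines_def)
    have nar: "narrow V r k (graph_state V E ?P R)"
      by (rule narrow_coarsen[OF ref2 less.prems(2) subset_refl less.prems(3)])
    have "card ?P \<le> Suc (card (P - {A, B}))" by (rule card_insert_le_m1) auto
    also have "\<dots> < card P"
    proof -
      have "card {A, B} \<le> card P" using AB less.prems(2) by (intro card_mono) auto
      then show ?thesis using AB less.prems(2) by (simp add: card_Diff_subset)
    qed
    finally have "(narrow_step V r k)\<^sup>*\<^sup>* (graph_state V E ?P R) (graph_state V E Q R)"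
      using less.hyps[OF _ ref1 _ nar] less.prems(2) by blast
    moreover have "cstep (graph_state V E P R) (graph_state V E ?P R)"
      using cstep.merge[of A "graph_state V E P R" B] AB by (simp add: graph_state_def)
    ultimately show ?thesis using nar by (meson converse_rtranclp_into_rtranclp narrow_step_def)
  next
    case False
    have sub: "A = C" if "A \<in> P" "C \<in> Q" "A \<subseteq> C" for A C
    proof
      show "C \<subseteq> A"
      proof
        fix x assume x: "x \<in> C"
        then have "x \<in> V" using that(2) partition_onD1[OF part(2)] by blast
        then obtain B where B: "B \<in> P" "x \<in> B" using partition_onD1[OF part(1)] by blast
        then obtain D where D: "D \<in> Q" "B \<subseteq> D" using ref by blast
        then have "D = C" using partition_onD2[OF part(2)] that(2) x B(2) by (auto simp: disjoint_def)
        then have "A = B" using False that B(1) D(2) by blast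
        then show "x \<in> A" using B(2) by simp
      qed
    qed (use that in simp)
    have "P = Q"
    proof
      show "P \<subseteq> Q" using ref sub by blast
      show "Q \<subseteq> P"
      proof
        fix C assume C: "C \<in> Q"
        then obtain x where "x \<in> C" using partition_onD3[OF part(2)] by (metis all_not_in_conv)
        moreover from this have "x \<in> V" using C partition_onD1[OF part(2)] by blast
        then obtain A where A: "A \<in> P" "x \<in> A" using partition_onD1[OF part(1)] by blast
        moreover obtain D where D: "D \<in> Q" "A \<subseteq> D" using ref A by blast
        ultimately have "D = C" using partition_onD2[OF part(2)] C by (auto simp: disjoint_def)
        then show "C \<in> P" using sub[OF A(1) D] A(1) by simp
      qed
    qed
    then show ?thesis by simp
  qed
qed

lemma narrow_steps_list:
  assumes "(narrow_step V r k)\<^sup>*\<^sup>* s t" "narrow V r k s"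
  shows "\<exists>ss. ss \<noteq> [] \<and> hd ss = s \<and> last ss = t \<and> successively cstep ss \<and> (\<forall>u\<in>set ss. narrow V r k u)"
  using assms(1)
proof (induction rule: rtranclp_induct)
  case base
  then show ?case using assms(2) by (intro exI[of _ "[s]"]) simp
next
  case (step t u)
  then obtain ss where "ss \<noteq> []" "hd ss = s" "last ss = t" "successively cstep ss" "\<forall>u\<in>set ss. narrow V r k u"
    by blast
  then show ?case
    using step.hyps(2) by (intro exI[of _ "ss @ [u]"]) (auto simp: successively_append_iff narrow_step_def)
qed

lemma width_leI:
  assumes "\<And>s. s \<in> set ss \<Longrightarrow> narrow V r k s"
  shows "width V r ss \<le> k"
  unfolding width_def using assms by (intro Least_le) (simp add: narrow_def)

lemma merge_width_leI:
  assumes "construction_sequence_of G ss" "\<And>s. s \<in> set ss \<Longrightarrow> narrow (verts G) r k s"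
  shows "merge_width r G \<le> enat k"
  unfolding merge_width_def
  by (rule INF_lower2[of ss]) (use assms width_leI[of ss "verts G" r k] in auto)

text \<open>
  A set of extended naturals attains its infimum, and the width is the least bound in a set of naturals
  that is nonempty because the sequence and the graph are finite.
\<close>

lemma merge_width_leE:
  assumes "merge_width r G \<le> enat k" "finite (verts G)"
  obtains ss where "construction_sequence_of G ss" "\<And>s. s \<in> set ss \<Longrightarrow> narrow (verts G) r k s"
proof -
  let ?W = "(\<lambda>ss. enat (width (verts G) r ss)) ` {ss. construction_sequence_of G ss}"
  have "?W \<noteq> {}"
  proof
    assume "?W = {}"
    then have "merge_width r G = \<infinity>" unfolding merge_width_def by (metis Inf_empty top_enat_def)
    then show False using assms(1) by simp
  qed
  then have "Inf ?W \<in> ?W" by (rule wellorder_InfI[OF ex_in_conv[THEN iffD2, THEN someI_ex]])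
  then obtain ss where ss: "construction_sequence_of G ss" "Inf ?W = enat (width (verts G) r ss)" by blast
  then have le: "width (verts G) r ss \<le> k" using assms(1) by (simp add: merge_width_def)
  let ?Q = "\<lambda>k. \<forall>s\<in>set ss. \<forall>v\<in>verts G. card (reachable_parts (verts G) r s v) \<le> k"
  let ?M = "\<Sum>s\<in>set ss. \<Sum>v\<in>verts G. card (reachable_parts (verts G) r s v)"
  have "?Q ?M"
  proof (intro ballI)
    fix s v assume "s \<in> set ss" "v \<in> verts G"
    have "card (reachable_parts (verts G) r s v) \<le> (\<Sum>v\<in>verts G. card (reachable_parts (verts G) r s v))"
      using assms(2) \<open>v \<in> verts G\<close> by (intro member_le_sum) auto
    also have "\<dots> \<le> ?M"
      using \<open>s \<in> set ss\<close> by (intro member_le_sum[of s "set ss"]) auto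
    finally show "card (reachable_parts (verts G) r s v) \<le> ?M" .
  qed
  then have "?Q (width (verts G) r ss)" unfolding width_def by (rule LeastI[of ?Q])
  then have "narrow (verts G) r k s" if "s \<in> set ss" for s
    using le that unfolding narrow_def by (meson order_trans)
  with ss(1) show thesis by (rule that)
qed

lemma bounded_merge_width_iff:
  "bounded_merge_width \<C> \<longleftrightarrow> (\<forall>r. \<exists>k. \<forall>G\<in>\<C>. merge_width r G \<le> enat k)"
proof -
  have "(SUP G\<in>\<C>. merge_width r G) < \<infinity> \<longleftrightarrow> (\<exists>k. \<forall>G\<in>\<C>. merge_width r G \<le> enat k)" for r
  proof
    assume "(SUP G\<in>\<C>. merge_width r G) < \<infinity>"
    then obtain k where "(SUP G\<in>\<C>. merge_width r G) = enat k" by (cases "SUP G\<in>\<C>. merge_width r G") auto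
    then show "\<exists>k. \<forall>G\<in>\<C>. merge_width r G \<le> enat k" by (metis SUP_upper)
  next
    assume "\<exists>k. \<forall>G\<in>\<C>. merge_width r G \<le> enat k"
    then obtain k where "(SUP G\<in>\<C>. merge_width r G) \<le> enat k" by (metis SUP_least)
    then show "(SUP G\<in>\<C>. merge_width r G) < \<infinity>" by (metis enat_ord_simps(4) infinity_ileE not_le)
  qed
  then show ?thesis by (simp add: bounded_merge_width_def)
qed

section \<open>The states of a construction sequence as labelled structures\<close>

definition resolved :: "'a cstate \<Rightarrow> 'a rel" where
  "resolved s = {(a, b). {a, b} \<in> pos s \<union> neg s}"

text \<open>
  As the parts form a partition, this set contains the part of \<open>v\<close> only. It serves as label of \<open>v\<close>.
\<close>

definition parts_of :: "'a cstate \<Rightarrow> 'a \<Rightarrow> 'a set set" where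
  "parts_of s v = {A \<in> parts s. v \<in> A}"

definition consistent :: "'a set \<Rightarrow> 'a cstate \<Rightarrow> bool" where
  "consistent V s \<longleftrightarrow> partition_on V (parts s) \<and> pos s \<union> neg s \<union> unres s = nsets V 2 \<and>
     pos s \<inter> neg s = {} \<and> unres s \<inter> (pos s \<union> neg s) = {}"

lemma consistent_initial: "consistent V (initial_state V)"
  by (simp add: consistent_def initial_state_def partition_on_singletons)

lemma consistent_step:
  assumes "consistent V s" "cstep s s'"
  shows "consistent V s'"
  using assms(2)
proof cases
  case (merge A B)
  then show ?thesis
    using assms(1) partition_on_merge[of V "parts s" A B] by (simp add: consistent_def)
qed (use assms(1) in \<open>auto simp: consistent_def\<close>)

lemma consistent_steps:
  "successively cstep (s # ss) \<Longrightarrow> consistent V s \<Longrightarrow> t \<in> set (s # ss) \<Longrightarrow> consistent V t"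
proof (induction ss arbitrary: s)
  case (Cons u ss)
  then show ?case using consistent_step[of V s u] by auto
qed simp

lemma nsets_2_pair: "{a, b} \<in> nsets V 2 \<longleftrightarrow> a \<in> V \<and> b \<in> V \<and> a \<noteq> b"
  by (auto simp: nsets_def card_insert_if split: if_splits)

lemma parts_of_mem: "parts_of s a = parts_of s a' \<Longrightarrow> A \<in> parts s \<Longrightarrow> a \<in> A \<longleftrightarrow> a' \<in> A"
  by (auto simp: parts_of_def)

lemma pairs_between_pair: "{a, b} \<in> pairs_between A B \<longleftrightarrow> a \<in> A \<and> b \<in> B \<or> b \<in> A \<and> a \<in> B"
  unfolding pairs_between_def by (auto simp: doubleton_eq_iff)

lemma parts_of_step:
  assumes "cstep s s'" "parts_of s a = parts_of s a'"
  shows "parts_of s' a = parts_of s' a'"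
  using assms(1)
proof cases
  case (merge A B)
  have "parts_of s' v = (if v \<in> A \<union> B then {A \<union> B} else {}) \<union> (parts_of s v - {A, B})" for v
    unfolding merge(1) parts_of_def by auto
  moreover have "a \<in> A \<union> B \<longleftrightarrow> a' \<in> A \<union> B"
    using parts_of_mem[OF assms(2)] merge(2,3) by blast
  ultimately show ?thesis using assms(2) by simp
qed (use assms(2) in \<open>simp_all add: parts_of_def\<close>)

lemma steps_mono:
  "successively cstep (s # ss) \<Longrightarrow> pos s \<subseteq> pos (last (s # ss)) \<and> neg s \<subseteq> neg (last (s # ss))"
proof (induction ss arbitrary: s)
  case (Cons u ss)
  have "pos s \<subseteq> pos u \<and> neg s \<subseteq> neg u"
    using Cons.prems by (auto elim!: cstep.cases)
  then show ?case using Cons.IH[of u] Cons.prems by auto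
qed simp

text \<open>
  Two unresolved pairs between the same parts are unresolved, and between the same parts, until a single step
  resolves both.
\<close>

lemma unresolved_decided_by_parts:
  assumes "successively cstep (s # ss)" "consistent V s" "unres (last (s # ss)) = {}"
    and "{a, b} \<in> unres s" "{a', b'} \<in> unres s"
    and "parts_of s a = parts_of s a'" "parts_of s b = parts_of s b'"
  shows "{a, b} \<in> pos (last (s # ss)) \<longleftrightarrow> {a', b'} \<in> pos (last (s # ss))"
  using assms
proof (induction ss arbitrary: s)
  case (Cons u ss)
  have step: "cstep s u" and tail: "successively cstep (u # ss)" using Cons.prems(1) by auto
  have u: "consistent V u" by (rule consistent_step[OF Cons.prems(2) step])
  have mono: "pos u \<subseteq> pos (last (u # ss))" "neg u \<subseteq> neg (last (u # ss))"
    using steps_mono[OF tail] by auto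
  have disj: "pos (last (u # ss)) \<inter> neg (last (u # ss)) = {}"
    using consistent_steps[OF tail u, of "last (u # ss)"] by (simp add: consistent_def)
  have later: ?case if "{a, b} \<in> unres u" "{a', b'} \<in> unres u"
    using Cons.IH[OF tail u _ that parts_of_step[OF step Cons.prems(6)] parts_of_step[OF step Cons.prems(7)]]
      Cons.prems(3) by simp
  have same_pair: "{a, b} \<in> pairs_between A B \<longleftrightarrow> {a', b'} \<in> pairs_between A B"
    if "A \<in> parts s" "B \<in> parts s" for A B
    unfolding pairs_between_pair
    using parts_of_mem[OF Cons.prems(6) that(1)] parts_of_mem[OF Cons.prems(6) that(2)]
      parts_of_mem[OF Cons.prems(7) that(1)] parts_of_mem[OF Cons.prems(7) that(2)] by argo
  from step show ?case
  proof cases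
    case (merge A B)
    then show ?thesis using later Cons.prems(4,5) by simp
  next
    case (resolve_pos A B)
    note same = same_pair[OF resolve_pos(2,3)]
    show ?thesis
    proof (cases "{a, b} \<in> pairs_between A B")
      case True
      then have "{a, b} \<in> pos u" "{a', b'} \<in> pos u" using same resolve_pos(1) Cons.prems(4,5) by auto
      then show ?thesis using mono(1) by auto
    next
      case False
      then show ?thesis using same resolve_pos(1) Cons.prems(4,5) by (intro later) auto
    qed
  next
    case (resolve_neg A B)
    note same = same_pair[OF resolve_neg(2,3)]
    show ?thesis
    proof (cases "{a, b} \<in> pairs_between A B")
      case True
      then have "{a, b} \<in> neg u" "{a', b'} \<in> neg u" using same resolve_neg(1) Cons.prems(4,5) by auto
      then show ?thesis using mono(2) disj by auto
    next
      case False
      then show ?thesis using same resolve_neg(1) Cons.prems(4,5) by (intro later) auto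
    qed
  qed
qed simp

text \<open>
  In the second case, resolving makes all pairs between \<open>A\<close> and \<open>B\<close> resolved, whether or not they were before; a
  description without reference to unresolved pairs, which is quantifier-free in labels.
\<close>

lemma step_resolved_cases:
  assumes "consistent V s" "cstep s s'"
  obtains (same) "resolved s' = resolved s"
  | (new) A B where "A \<in> parts s" "B \<in> parts s" "parts s' = parts s"
      "resolved s' = resolved s \<union> {(a, b). a \<in> V \<and> b \<in> V \<and> a \<noteq> b \<and> (a \<in> A \<and> b \<in> B \<or> b \<in> A \<and> a \<in> B)}"
proof -
  have nsets: "{a, b} \<in> unres s \<union> (pos s \<union> neg s) \<longleftrightarrow> a \<in> V \<and> b \<in> V \<and> a \<noteq> b" for a b
  proof -
    have "unres s \<union> (pos s \<union> neg s) = nsets V 2"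
      using assms(1) unfolding consistent_def by blast
    then show ?thesis by (simp only: nsets_2_pair)
  qed
  have new': "resolved s' = resolved s \<union> {(a, b). a \<in> V \<and> b \<in> V \<and> a \<noteq> b \<and> (a \<in> A \<and> b \<in> B \<or> b \<in> A \<and> a \<in> B)}"
    if *: "pos s' \<union> neg s' = pos s \<union> neg s \<union> (unres s \<inter> pairs_between A B)" for A B
  proof -
    have "{a, b} \<in> pos s' \<union> neg s' \<longleftrightarrow> {a, b} \<in> pos s \<union> neg s \<or>
        a \<in> V \<and> b \<in> V \<and> a \<noteq> b \<and> (a \<in> A \<and> b \<in> B \<or> b \<in> A \<and> a \<in> B)" for a b
      unfolding * using nsets[of a b] pairs_between_pair[of a b A B] by blast
    then show ?thesis by (auto simp: resolved_def)
  qed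
  from assms(2) show thesis
  proof cases
    case (merge A B)
    then show thesis by (intro same) (simp add: resolved_def)
  next
    case (resolve_pos A B)
    then show thesis by (intro new[of A B] new') auto
  next
    case (resolve_neg A B)
    then show thesis by (intro new[of A B] new') auto
  qed
qed

text \<open>
  The part of a walk up to its first new edge lies in the old relation, and a new edge starts in one of the
  resolved parts \<open>A, B\<close>.
\<close>

lemma near_new_end:
  assumes "(u, v) \<in> near R' d" "R' = R \<union> {(a, b). a \<in> V \<and> b \<in> V \<and> a \<noteq> b \<and> (a \<in> A \<and> b \<in> B \<or> b \<in> A \<and> a \<in> B)}"
  shows "(u, v) \<in> near R d \<or> (\<exists>m\<in>A \<union> B. (u, m) \<in> near R d)"
  using assms(1)
proof (induction d arbitrary: v)
  case (Suc d)
  obtain c where c: "(u, c) \<in> near R' d" "(c, v) \<in> R'\<^sup>=" using Suc.prems by (rule near_SucE)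
  from Suc.IH[OF c(1)] show ?case
  proof
    assume uc: "(u, c) \<in> near R d"
    show ?thesis
    proof (cases "(c, v) \<in> R\<^sup>=")
      case True
      then show ?thesis using near_SucI[OF uc] by blast
    next
      case False
      then have "c \<in> A \<union> B" using c(2) assms(2) by auto
      then show ?thesis using near_mono[OF uc, of "Suc d"] by auto
    qed
  next
    assume "\<exists>m\<in>A \<union> B. (u, m) \<in> near R d"
    then show ?thesis using near_mono[of u _ R d "Suc d"] by auto
  qed
qed simp

lemma near_new_within:
  assumes "R' = R \<union> {(a, b). a \<in> V \<and> b \<in> V \<and> a \<noteq> b \<and> (a \<in> A \<and> b \<in> B \<or> b \<in> A \<and> a \<in> B)}"
    and "A \<subseteq> V" "B \<subseteq> V" "A \<noteq> {}" "B \<noteq> {}" "m \<in> A \<union> B" "m' \<in> A \<union> B"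
  shows "(m, m') \<in> near R' 2"
proof -
  have adj: "(a, b) \<in> R'\<^sup>=" "(b, a) \<in> R'\<^sup>=" if "a \<in> A" "b \<in> B" for a b
    using that assms(1-3) by auto
  have two: "(a, c) \<in> near R' 2" if "(a, b) \<in> R'\<^sup>=" "(b, c) \<in> R'\<^sup>=" for a b c
    using near_SucI[of a b R' "Suc 0" c] that by (simp add: numeral_2_eq_2)
  obtain a b where "a \<in> A" "b \<in> B" using assms(4,5) by blast
  then show ?thesis
    using assms(6,7) two[of m b m'] two[of m a m'] two[of m m m'] adj by blast
qed

section \<open>The construction sequence of a transduced graph\<close>

text \<open>
  Paths have no repeated vertices, so a walk that returns to its path is cut back.
\<close>

lemma near_path:
  assumes "(v, w) \<in> near (resolved s) d" "v \<in> V" "consistent V s"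
  shows "\<exists>p. path \<lparr>verts = V, edges = pos s \<union> neg s\<rparr> p \<and> hd p = v \<and> last p = w \<and> length p - 1 \<le> d"
  using assms(1)
proof (induction d arbitrary: w)
  case 0
  then show ?case using assms(2) by (intro exI[of _ "[v]"]) (simp add: path_def)
next
  case (Suc d)
  obtain c where c: "(v, c) \<in> near (resolved s) d" "(c, w) \<in> (resolved s)\<^sup>=" using Suc.prems by (rule near_SucE)
  obtain p where p: "path \<lparr>verts = V, edges = pos s \<union> neg s\<rparr> p" "hd p = v" "last p = c" "length p - 1 \<le> d"
    using Suc.IH[OF c(1)] by blast
  show ?case
  proof (cases "w \<in> set p")
    case True
    then obtain ys zs where yz: "p = ys @ w # zs" by (meson split_list)
    have "path \<lparr>verts = V, edges = pos s \<union> neg s\<rparr> (ys @ [w])"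
      using p(1) unfolding path_def yz by (auto simp: successively_append_iff)
    moreover have "hd (ys @ [w]) = v" using p(2) yz by (cases ys) auto
    ultimately show ?thesis using p(4) yz by (intro exI[of _ "ys @ [w]"]) simp
  next
    case False
    have "p \<noteq> []" using p(1) by (simp add: path_def)
    then have "c \<noteq> w" using False p(3) last_in_set by blast
    then have cw: "{c, w} \<in> pos s \<union> neg s" using c(2) by (auto simp: resolved_def)
    moreover have "pos s \<union> neg s \<subseteq> nsets V 2" using assms(3) unfolding consistent_def by blast
    ultimately have "w \<in> V" using nsets_2_pair[of c w V] by blast
    then have "path \<lparr>verts = V, edges = pos s \<union> neg s\<rparr> (p @ [w])"
      using p(1,3) False cw unfolding path_def by (auto simp: successively_append_iff)
    then show ?thesis
      using p(2,4) \<open>p \<noteq> []\<close> by (intro exI[of _ "p @ [w]"]) simp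
  qed
qed

lemma narrow_near:
  assumes "narrow V r k s" "consistent V s" "finite V" "v \<in> V"
  shows "card {A \<in> parts s. \<exists>w\<in>A. (v, w) \<in> near (resolved s) r} \<le> k"
proof -
  have "finite (parts s)" using assms(2,3) by (auto simp: consistent_def intro: finite_elements)
  then have "card {A \<in> parts s. \<exists>w\<in>A. (v, w) \<in> near (resolved s) r} \<le> card (reachable_parts V r s v)"
    using near_path[OF _ assms(4,2), folded reachable_within_def]
    by (intro card_mono) (auto simp: reachable_parts_def)
  then show ?thesis using assms(1,4) unfolding narrow_def by fastforce
qed

lemma path_near:
  assumes edge: "\<And>x y. {x, y} \<in> R \<Longrightarrow> x \<in> U \<Longrightarrow> y \<in> U \<Longrightarrow> (g x, g y) \<in> near S c"
    and "reachable_within \<lparr>verts = U, edges = R\<rparr> r v w"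
  shows "(g v, g w) \<in> near S (r * c)"
proof -
  obtain p where p: "p \<noteq> []" "set p \<subseteq> U" "successively (\<lambda>u w. {u, w} \<in> R) p"
    "hd p = v" "last p = w" "length p - 1 \<le> r"
    using assms(2) by (auto simp: reachable_within_def path_def)
  have "(g (hd p), g (last p)) \<in> near S ((length p - 1) * c)"
    using p(1-3)
  proof (induction p rule: induct_list012)
    case (3 x y zs)
    have "(g x, g y) \<in> near S c" using 3 by (intro edge) auto
    from near_trans[OF this] 3 show ?case by simp
  qed simp_all
  then show ?thesis using p(4-6) near_mono[of _ _ S "(length p - 1) * c" "r * c"] by simp
qed

text \<open>
  The constants of the construction: pairs at distance beyond \<open>2 ^ far_rank \<phi>\<close> are far apart; vertices are
  compared by global equivalence of rank \<open>type_rank \<phi>\<close>, which is enough for \<open>glob_far_pair\<close> and one more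
  round, used in \<open>same_type_witness\<close>; and width at radius \<open>source_radius \<phi> r\<close> in the given graph controls width at
  radius \<open>r\<close> in the transduced one. One edge of the new resolved graph corresponds to distance at most
  \<open>2 * 2 ^ far_rank \<phi> + 2\<close>, and the second summand of the source radius is the reach of the local game that
  determines the type.
\<close>

definition far_rank :: "fo \<Rightarrow> nat" where
  "far_rank \<phi> = locality_rank (quantifier_rank \<phi>) 2"

definition type_rank :: "fo \<Rightarrow> nat" where
  "type_rank \<phi> = Suc (far_rank \<phi> + 2 ^ far_rank \<phi>)"

definition source_radius :: "fo \<Rightarrow> nat \<Rightarrow> nat" where
  "source_radius \<phi> r = r * (2 * 2 ^ far_rank \<phi> + 2) + 2 ^ locality_rank (type_rank \<phi>) 1"

definition target_width :: "fo \<Rightarrow> nat \<Rightarrow> nat" where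
  "target_width \<phi> k = type_bound (k * 2 ^ card (colours \<phi>)) (locality_rank (type_rank \<phi>) 1) 1"

text \<open>
  \<open>H\<close> is transduced from \<open>G\<close> by \<open>\<phi>\<close> with colours \<open>P\<close>. The injection \<open>g\<close> of its vertices into those of \<open>G\<close>
  takes care of the choice of vertices and of the isomorphism at once.
\<close>

locale transduction =
  fixes G :: "'a ugraph" and P :: "nat \<Rightarrow> 'a set" and \<phi> :: fo and H :: "'b ugraph" and g :: "'b \<Rightarrow> 'a"
  assumes G: "finite_simple_graph G" and H: "finite_simple_graph H"
    and g: "inj_on g (verts H)" "g ` verts H \<subseteq> verts G"
    and \<phi>: "free_vars \<phi> \<subseteq> {0, 1}"
    and edges_H: "\<lbrakk>x \<in> verts H; y \<in> verts H; x \<noteq> y\<rbrakk> \<Longrightarrow>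
      {x, y} \<in> edges H \<longleftrightarrow> sat2 G P \<phi> (g x) (g y) \<or> sat2 G P \<phi> (g y) (g x)"
begin

abbreviation "V \<equiv> verts G"
abbreviation "U \<equiv> verts H"
abbreviation "E \<equiv> {(u, v). {u, v} \<in> edges G}"

definition lab :: "'a cstate \<Rightarrow> 'a \<Rightarrow> 'a set set \<times> nat set" where
  "lab s v = (parts_of s v, {i \<in> colours \<phi>. v \<in> P i})"

definition valid :: "'a cstate \<Rightarrow> bool" where
  "valid s \<longleftrightarrow> consistent V s \<and>
    (\<forall>a b a' b'. {a, b} \<in> unres s \<longrightarrow> {a', b'} \<in> unres s \<longrightarrow> parts_of s a = parts_of s a' \<longrightarrow>
       parts_of s b = parts_of s b' \<longrightarrow> ({a, b} \<in> edges G \<longleftrightarrow> {a', b'} \<in> edges G))"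

abbreviation same_type :: "'a cstate \<Rightarrow> nat \<Rightarrow> 'a rel \<Rightarrow> bool" where
  "same_type s \<equiv> global_equiv V (resolved s) E (lab s)"

lemma finite_V: "finite V" and finite_U: "finite U" and g_V: "x \<in> U \<Longrightarrow> g x \<in> V"
  using G H g(2) by (auto simp: finite_simple_graph_def)

lemma resolved_or_unres:
  assumes "consistent V s" "a \<in> V" "b \<in> V" "a \<noteq> b"
  shows "(a, b) \<in> resolved s \<or> {a, b} \<in> unres s"
proof -
  have "{a, b} \<in> pos s \<union> neg s \<union> unres s"
    using assms nsets_2_pair[of a b V] unfolding consistent_def by simp
  then show ?thesis by (auto simp: resolved_def)
qed

lemma valid_unres:
  assumes "valid s" "{a, b} \<in> unres s" "{a', b'} \<in> unres s"
    and "parts_of s a = parts_of s a'" "parts_of s b = parts_of s b'"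
  shows "{a, b} \<in> edges G \<longleftrightarrow> {a', b'} \<in> edges G"
  using assms unfolding valid_def by blast

lemma state_structure: "valid s \<Longrightarrow> labelled_structure V (resolved s) E (lab s)"
proof
  assume s: "valid s"
  have cons: "consistent V s" using s by (simp add: valid_def)
  have sub: "pos s \<union> neg s \<subseteq> nsets V 2" using s unfolding valid_def consistent_def by blast
  then show "resolved s \<subseteq> V \<times> V" "irrefl (resolved s)"
    using nsets_2_pair[of _ _ V] unfolding resolved_def irrefl_def by blast+
  show "sym (resolved s)" "sym E" by (auto simp: resolved_def sym_def insert_commute)
  show "(u, v) \<in> E \<longleftrightarrow> (u', v') \<in> E"
    if "u \<in> V" "v \<in> V" "u' \<in> V" "v' \<in> V" "(u, v) \<notin> (resolved s)\<^sup>=" "(u', v') \<notin> (resolved s)\<^sup>="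
      "lab s u = lab s u'" "lab s v = lab s v'" for u v u' v'
  proof -
    have "{u, v} \<in> unres s" "{u', v'} \<in> unres s"
      using that(1-6) resolved_or_unres[OF cons, of u v] resolved_or_unres[OF cons, of u' v'] by auto
    from valid_unres[OF s this] show ?thesis using that(7,8) by (simp add: lab_def)
  qed
qed (rule finite_V)

text \<open>
  The partition of the vertices of \<open>H\<close> into types can only become coarser from one state to the next.
\<close>

lemma same_type_step:
  assumes s: "valid s" and step: "cstep s s'" and T: "T \<subseteq> V \<times> V" "same_type s q T"
  shows "same_type s' q T"
proof (rule global_equiv_transfer[OF _ T])
  fix T :: "'a rel" assume T: "T \<subseteq> V \<times> V" "partial_iso (resolved s) E (lab s) T"
  have parts: "parts_of s a = parts_of s a'" if "(a, a') \<in> T" for a a'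
    using partial_iso_simps(1)[OF T(2) that] by (simp add: lab_def)
  show "partial_iso (resolved s') E (lab s') T"
  proof (rule partial_isoI)
    fix a a' assume a: "(a, a') \<in> T"
    show "lab s' a = lab s' a'"
      using partial_iso_simps(1)[OF T(2) a] parts_of_step[OF step parts[OF a]] by (simp add: lab_def)
    fix b b' assume b: "(b, b') \<in> T"
    note old = partial_iso_simps(2-)[OF T(2) a b]
    have V: "a \<in> V" "a' \<in> V" "b \<in> V" "b' \<in> V" using T(1) a b by auto
    have "(a, b) \<in> resolved s' \<longleftrightarrow> (a', b') \<in> resolved s'"
      using s[unfolded valid_def, THEN conjunct1] step
    proof (cases rule: step_resolved_cases)
      case same
      then show ?thesis using old by simp
    next
      case (new A B)
      show ?thesis
        unfolding new(4) using old V parts_of_mem[OF parts[OF a] new(1)] parts_of_mem[OF parts[OF a] new(2)]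
          parts_of_mem[OF parts[OF b] new(1)] parts_of_mem[OF parts[OF b] new(2)] by simp
    qed
    then show "(a = b \<longleftrightarrow> a' = b') \<and> ((a, b) \<in> resolved s' \<longleftrightarrow> (a', b') \<in> resolved s') \<and>
        ((a, b) \<in> E \<longleftrightarrow> (a', b') \<in> E)"
      using old by blast
  qed
qed

definition eqv :: "'a cstate \<Rightarrow> 'b rel" where
  "eqv s = {(x, y). x \<in> U \<and> y \<in> U \<and> same_type s (type_rank \<phi>) {(g x, g y)}}"

definition classes :: "'a cstate \<Rightarrow> 'b set set" where
  "classes s = U // eqv s"

lemma equiv_eqv:
  assumes "valid s" shows "equiv U (eqv s)"
proof -
  interpret labelled_structure V "resolved s" E "lab s" by (rule state_structure[OF assms])
  show ?thesis
  proof (rule equivI)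
    show "eqv s \<subseteq> U \<times> U" by (auto simp: eqv_def)
    show "refl_on U (eqv s)" using glob_Id by (auto simp: eqv_def refl_on_def)
    show "sym (eqv s)" using glob_sym1 by (auto simp: eqv_def sym_def)
    show "trans (eqv s)" using glob_trans1 by (force simp: eqv_def trans_def)
  qed
qed

lemma partition_classes: "valid s \<Longrightarrow> partition_on U (classes s)"
  unfolding classes_def by (rule partition_on_quotient[OF equiv_eqv])

lemma finite_classes: "finite (classes s)"
  unfolding classes_def eqv_def using finite_U by (intro finite_quotient) auto

lemma classes_eqv: "valid s \<Longrightarrow> X \<in> classes s \<Longrightarrow> x \<in> X \<Longrightarrow> y \<in> X \<Longrightarrow> (x, y) \<in> eqv s"
  unfolding classes_def using in_quotient_imp_in_rel[OF equiv_eqv] by blast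

lemma eqv_step:
  assumes "valid s" "cstep s s'"
  shows "eqv s \<subseteq> eqv s'"
  using same_type_step[OF assms] g_V unfolding eqv_def by auto

lemma refines_classes:
  assumes "valid s" "valid s'" "eqv s \<subseteq> eqv s'"
  shows "refines U (classes s) (classes s')"
  unfolding refines_def
proof (intro conjI ballI)
  fix X assume "X \<in> classes s"
  then obtain x where "x \<in> U" "X = eqv s `` {x}" unfolding classes_def by (rule quotientE)
  then show "\<exists>Y\<in>classes s'. X \<subseteq> Y" using assms(3) unfolding classes_def by (blast intro: quotientI)
qed (use partition_classes assms in blast)+

text \<open>
  The set \<open>S\<close> is the resolved relation of the state \<open>s\<close> or of its successor. In the second case the pairs have
  already been resolved as required by the successor while the parts are still the classes at \<open>s\<close>, the
  critical moment for the width.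
\<close>

lemma narrow_classes:
  assumes s: "valid s"
    and R: "\<And>x y. x \<in> U \<Longrightarrow> y \<in> U \<Longrightarrow> {x, y} \<in> R \<Longrightarrow> (g x, g y) \<in> near S (2 * 2 ^ far_rank \<phi> + 2)"
    and S: "resolved s \<subseteq> S"
    and few: "\<And>v. v \<in> V \<Longrightarrow> card {A \<in> parts s. \<exists>w\<in>A. (v, w) \<in> near S (source_radius \<phi> r)} \<le> k"
  shows "narrow U r (target_width \<phi> k) (graph_state U (edges H) (classes s) R)"
  unfolding narrow_def
proof
  interpret labelled_structure V "resolved s" E "lab s" by (rule state_structure[OF s])
  fix x assume x: "x \<in> U"
  let ?X = "reachable_parts U r (graph_state U (edges H) (classes s) R) x"
  let ?p = "locality_rank (type_rank \<phi>) 1" and ?d = "r * (2 * 2 ^ far_rank \<phi> + 2)"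
  define B where "B = {b \<in> V. (g x, b) \<in> near S ?d}"
  let ?parts = "{A \<in> parts s. \<exists>w\<in>A. (g x, w) \<in> near S (source_radius \<phi> r)}"
  have part: "partition_on V (parts s)" using s by (simp add: valid_def consistent_def)
  have "lab s b \<in> (\<lambda>(A, c). ({A}, c)) ` (?parts \<times> Pow (colours \<phi>))" if "b \<in> ball (2 ^ ?p) B" for b
  proof -
    from that obtain a where a: "b \<in> V" "a \<in> B" "(a, b) \<in> near (resolved s) (2 ^ ?p)" by (auto simp: ball_def)
    have "(g x, b) \<in> near S (source_radius \<phi> r)"
      unfolding source_radius_def
    proof (rule near_trans)
      show "(g x, a) \<in> near S ?d" using a(2) by (simp add: B_def)
      show "(a, b) \<in> near S (2 ^ ?p)" by (rule near_rel_mono[OF S a(3)])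
    qed
    moreover obtain A where A: "A \<in> parts s" "b \<in> A" using partition_onD1[OF part] a(1) by blast
    moreover have "parts_of s b = {A}"
      using A partition_onD2[OF part] by (auto simp: parts_of_def disjoint_def)
    ultimately show ?thesis
      unfolding lab_def by (intro image_eqI[of _ _ "(A, {i \<in> colours \<phi>. b \<in> P i})"]) auto
  qed
  then have sub: "lab s ` ball (2 ^ ?p) B \<subseteq> (\<lambda>(A, c). ({A}, c)) ` (?parts \<times> Pow (colours \<phi>))" by blast
  have fin: "finite ?parts" using finite_elements[OF finite_V part] by simp
  have "card (lab s ` ball (2 ^ ?p) B) \<le> card ((\<lambda>(A, c). ({A}, c)) ` (?parts \<times> Pow (colours \<phi>)))"
    using fin finite_colours by (intro card_mono[OF _ sub]) simp
  also have "\<dots> \<le> card (?parts \<times> Pow (colours \<phi>))"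
    using fin finite_colours by (intro card_image_le) simp
  also have "\<dots> = card ?parts * 2 ^ card (colours \<phi>)"
    by (simp add: card_cartesian_product card_Pow finite_colours)
  also have "\<dots> \<le> k * 2 ^ card (colours \<phi>)" using few[OF g_V[OF x]] by simp
  finally have "card (lab s ` ball (2 ^ ?p) B) \<le> k * 2 ^ card (colours \<phi>)" .
  then obtain \<tau> :: "'a \<Rightarrow> nat" where \<tau>: "\<And>a. a \<in> B \<Longrightarrow> \<tau> a < target_width \<phi> k"
    "\<And>a b. a \<in> B \<Longrightarrow> b \<in> B \<Longrightarrow> \<tau> a = \<tau> b \<Longrightarrow> same_type s (type_rank \<phi>) {(a, b)}"
    using glob_colouring[of B "type_rank \<phi>" "k * 2 ^ card (colours \<phi>)"]
    unfolding target_width_def B_def by blast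
  have "\<forall>X\<in>?X. \<exists>w\<in>X. w \<in> U \<and> g w \<in> B"
  proof
    fix X assume "X \<in> ?X"
    then obtain w where w: "X \<in> classes s" "w \<in> X" "reachable_within \<lparr>verts = U, edges = R\<rparr> r x w"
      by (auto simp: reachable_parts_graph_state)
    then have "w \<in> U" using partition_onD1[OF partition_classes[OF s]] by blast
    moreover have "(g x, g w) \<in> near S ?d"
      by (rule path_near[OF _ w(3)]) (use R in blast)
    ultimately show "\<exists>w\<in>X. w \<in> U \<and> g w \<in> B" using w(2) g_V by (auto simp: B_def)
  qed
  then obtain h where h: "\<And>X. X \<in> ?X \<Longrightarrow> h X \<in> X \<and> h X \<in> U \<and> g (h X) \<in> B" by metis
  have "inj_on (\<lambda>X. \<tau> (g (h X))) ?X"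
  proof (rule inj_onI)
    fix X Y assume XY: "X \<in> ?X" "Y \<in> ?X" "\<tau> (g (h X)) = \<tau> (g (h Y))"
    then have "(h X, h Y) \<in> eqv s" using \<tau>(2) h unfolding eqv_def by simp
    moreover have "X \<in> classes s" "Y \<in> classes s" using XY(1,2) by (auto simp: reachable_parts_graph_state)
    ultimately show "X = Y"
      using quotient_eqI[OF equiv_eqv[OF s]] h XY(1,2) unfolding classes_def by metis
  qed
  then have "card ?X \<le> card {..<target_width \<phi> k}"
    by (rule card_inj_on_le) (use \<tau>(1) h in auto)
  then show "card ?X \<le> target_width \<phi> k" by simp
qed

lemma same_type_sat2:
  assumes s: "valid s" and T: "same_type s (quantifier_rank \<phi>) T" "(u, u') \<in> T" "(v, v') \<in> T"
  shows "sat2 G P \<phi> u v \<longleftrightarrow> sat2 G P \<phi> u' v'"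
proof -
  interpret labelled_structure V "resolved s" E "lab s" by (rule state_structure[OF s])
  show ?thesis unfolding sat2_def
  proof (rule sat_glob[OF _ _ _ T(1)])
    show "w' \<in> P i" if "i \<in> colours \<phi>" "lab s w = lab s w'" "w \<in> P i" for i w w'
      using that unfolding lab_def by blast
    show "(((\<lambda>_. undefined)(0 := u, 1 := v)) z, ((\<lambda>_. undefined)(0 := u', 1 := v')) z) \<in> T"
      if "z \<in> free_vars \<phi>" for z
      using \<phi> that T(2,3) by auto
  qed simp_all
qed

definition far_apart :: "'a cstate \<Rightarrow> 'b \<Rightarrow> 'b \<Rightarrow> bool" where
  "far_apart s x y \<longleftrightarrow> (g x, g y) \<notin> near (resolved s) (2 ^ far_rank \<phi>)"

lemma far_apart_edges:
  assumes s: "valid s" and xy: "(x, x') \<in> eqv s" "(y, y') \<in> eqv s"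
    and far: "far_apart s x y" "far_apart s x' y'"
  shows "{x, y} \<in> edges H \<longleftrightarrow> {x', y'} \<in> edges H"
proof -
  interpret labelled_structure V "resolved s" E "lab s" by (rule state_structure[OF s])
  have U: "x \<in> U" "x' \<in> U" "y \<in> U" "y' \<in> U" using xy by (auto simp: eqv_def)
  have "same_type s (far_rank \<phi> + 2 ^ far_rank \<phi>) {(g x, g x')}" "same_type s (far_rank \<phi> + 2 ^ far_rank \<phi>) {(g y, g y')}"
    using xy glob_rank_mono[of "type_rank \<phi>" _ "far_rank \<phi> + 2 ^ far_rank \<phi>"]
    by (auto simp: eqv_def type_rank_def)
  then have "same_type s (quantifier_rank \<phi>) {(g x, g x'), (g y, g y')}"
    using glob_far_pair[of "g x" "g x'" "g y" "g y'" "quantifier_rank \<phi>"] U g_V far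
    unfolding far_apart_def far_rank_def by simp
  from same_type_sat2[OF s this, of "g x" "g x'" "g y" "g y'"] same_type_sat2[OF s this, of "g y" "g y'" "g x" "g x'"]
  have "sat2 G P \<phi> (g x) (g y) \<longleftrightarrow> sat2 G P \<phi> (g x') (g y')"
    "sat2 G P \<phi> (g y) (g x) \<longleftrightarrow> sat2 G P \<phi> (g y') (g x')" by simp_all
  moreover have "x \<noteq> y" "x' \<noteq> y'" using far by (auto simp: far_apart_def)
  ultimately show ?thesis using edges_H U by simp
qed

lemma same_type_witness:
  assumes s: "valid s" and xx: "(x, x') \<in> eqv s" and m: "m \<in> V" "(g x, m) \<in> near (resolved s) (2 ^ far_rank \<phi>)"
  obtains m' where "m' \<in> V" "parts_of s m = parts_of s m'" "(g x', m') \<in> near (resolved s) (2 ^ far_rank \<phi>)"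
proof -
  interpret labelled_structure V "resolved s" E "lab s" by (rule state_structure[OF s])
  have V: "g x \<in> V" "g x' \<in> V" using xx g_V by (auto simp: eqv_def)
  have "same_type s (Suc (far_rank \<phi> + 2 ^ far_rank \<phi>)) {(g x, g x')}"
    using xx by (simp add: eqv_def type_rank_def)
  then obtain m' where m': "m' \<in> V" "same_type s (far_rank \<phi> + 2 ^ far_rank \<phi>) (insert (m, m') {(g x, g x')})"
    using m(1) by (rule glob_forth)
  have "same_type s (2 ^ far_rank \<phi>) {(m, m'), (g x, g x')}"
    using glob_rank_mono[OF m'(2)] by simp
  then have "(g x', m') \<in> near (resolved s) (2 ^ far_rank \<phi>)"
    by (rule glob_near[of _ _ "g x" "g x'" m m']) (use V m m'(1) in auto)
  moreover have "parts_of s m = parts_of s m'"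
    using partial_iso_simps(1)[OF glob_iso[OF m'(2)], of m m'] by (simp add: lab_def)
  ultimately show thesis using m'(1) by (intro that)
qed

text \<open>
  If a step resolving \<open>A\<close> and \<open>B\<close> makes \<open>x\<close> and \<open>y\<close> near, both have been near \<open>A \<union> B\<close> before. So
  have \<open>x'\<close> and \<open>y'\<close> as they have the same types, and any two elements of \<open>A \<union> B\<close> have distance at
  most \<open>2\<close> afterwards.
\<close>

lemma newly_near:
  assumes s: "valid s" "valid s'" and step: "cstep s s'"
    and xy: "(x, x') \<in> eqv s" "(y, y') \<in> eqv s"
    and near: "far_apart s x y" "\<not> far_apart s' x y"
  shows "(g x', g y') \<in> near (resolved s') (2 * 2 ^ far_rank \<phi> + 2)"
proof -
  interpret S: labelled_structure V "resolved s" E "lab s" by (rule state_structure[OF s(1)])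
  interpret S': labelled_structure V "resolved s'" E "lab s'" by (rule state_structure[OF s(2)])
  let ?D = "2 ^ far_rank \<phi> :: nat"
  have cons: "consistent V s" using s(1) by (simp add: valid_def)
  from cons step show ?thesis
  proof (cases rule: step_resolved_cases)
    case same
    then show ?thesis using near by (simp add: far_apart_def)
  next
    case (new A B)
    have part: "partition_on V (parts s)" using cons by (simp add: consistent_def)
    have AB: "A \<subseteq> V" "B \<subseteq> V" "A \<noteq> {}" "B \<noteq> {}"
      using partition_onD1[OF part] partition_onD3[OF part] new(1,2) by auto
    have ends: "(g x, g y) \<in> near (resolved s') ?D" "(g y, g x) \<in> near (resolved s') ?D"
      "(g x, g y) \<notin> near (resolved s) ?D" "(g y, g x) \<notin> near (resolved s) ?D"
      using near S.near_commute S'.near_commute unfolding far_apart_def by metis+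
    have reach: "\<exists>m'\<in>A \<union> B. (g z', m') \<in> near (resolved s') ?D"
      if zz: "(z, z') \<in> eqv s" and zw: "(g z, w) \<in> near (resolved s') ?D" "(g z, w) \<notin> near (resolved s) ?D" for z z' w
    proof -
      obtain m where m: "m \<in> A \<union> B" "(g z, m) \<in> near (resolved s) ?D"
        using near_new_end[OF zw(1) new(4)] zw(2) by blast
      have "m \<in> V" using m(1) AB by blast
      then obtain m' where m': "m' \<in> V" "parts_of s m = parts_of s m'" "(g z', m') \<in> near (resolved s) ?D"
        using same_type_witness[OF s(1) zz _ m(2)] by blast
      have "m' \<in> A \<union> B"
        using parts_of_mem[OF m'(2) new(1)] parts_of_mem[OF m'(2) new(2)] m(1) by blast
      moreover have "(g z', m') \<in> near (resolved s') ?D"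
        by (rule near_rel_mono[OF _ m'(3)]) (use new(4) in blast)
      ultimately show ?thesis by blast
    qed
    obtain m where m: "m \<in> A \<union> B" "(g x', m) \<in> near (resolved s') ?D"
      using reach[OF xy(1) ends(1,3)] by blast
    obtain n where n: "n \<in> A \<union> B" "(g y', n) \<in> near (resolved s') ?D"
      using reach[OF xy(2) ends(2,4)] by blast
    have "(m, n) \<in> near (resolved s') 2" by (rule near_new_within[OF new(4) AB m(1) n(1)])
    moreover have "(n, g y') \<in> near (resolved s') ?D" using n(2) S'.near_commute by metis
    ultimately have "(g x', g y') \<in> near (resolved s') (?D + (2 + ?D))"
      using m(2) near_trans by metis
    then show ?thesis by (simp add: mult_2 add.commute add.left_commute)
  qed
qed

text \<open>
  The pairs resolved in \<open>H\<close> are not a function of the state \<open>s\<close> but depend on the history; they are only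
  sandwiched between two distances. The slack is there because \<open>glob_far_pair\<close> controls a far pair only up
  to the quantifier rank of \<open>\<phi>\<close>, which in general is too small to express nearness with threshold
  \<open>2 ^ far_rank \<phi>\<close>: of two far pairs with equal types at their entries, one may get near in the next step
  and the other only fairly near.
\<close>

definition well_resolved :: "'a cstate \<Rightarrow> 'b set set \<Rightarrow> bool" where
  "well_resolved s R \<longleftrightarrow> R \<subseteq> nsets U 2 \<and>
     (\<forall>x\<in>U. \<forall>y\<in>U. x \<noteq> y \<longrightarrow> \<not> far_apart s x y \<longrightarrow> {x, y} \<in> R) \<and>
     (\<forall>x\<in>U. \<forall>y\<in>U. {x, y} \<in> R \<longrightarrow> (g x, g y) \<in> near (resolved s) (2 * 2 ^ far_rank \<phi> + 2))"

abbreviation "steps r k \<equiv> (narrow_step U r (target_width \<phi> k))\<^sup>*\<^sup>*"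
abbreviation "state s R \<equiv> graph_state U (edges H) (classes s) R"

text \<open>
  Every two classes with a pair that gets near are resolved against each other, then classes are merged.
\<close>

lemma follow_step:
  assumes s: "valid s" "valid s'" and step: "cstep s s'" and R: "well_resolved s R"
    and narrow: "narrow V (source_radius \<phi> r) k s" "narrow V (source_radius \<phi> r) k s'"
  shows "\<exists>R'. well_resolved s' R' \<and> steps r k (state s R) (state s' R')"
proof -
  interpret S: labelled_structure V "resolved s" E "lab s" by (rule state_structure[OF s(1)])
  interpret S': labelled_structure V "resolved s'" E "lab s'" by (rule state_structure[OF s(2)])
  have cons: "consistent V s" "consistent V s'" using s by (simp_all add: valid_def)
  have grow: "resolved s \<subseteq> resolved s'"
    using cons(1) step by (cases rule: step_resolved_cases) auto
  define F where "F = {(X, Y). X \<in> classes s \<and> Y \<in> classes s \<and>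
    (\<exists>x\<in>X. \<exists>y\<in>Y. {x, y} \<notin> R \<and> far_apart s x y \<and> \<not> far_apart s' x y)}"
  define R' where "R' = R \<union> (\<Union>(X, Y)\<in>F. pairs_between X Y) \<inter> nsets U 2"
  have mem: "x \<in> U" if "x \<in> X" "X \<in> classes s" for x X
    using partition_onD1[OF partition_classes[OF s(1)]] that by blast
  have unres_far: "far_apart s x y" if "x \<in> U" "y \<in> U" "x \<noteq> y" "{x, y} \<notin> R" for x y
    using R that unfolding well_resolved_def by blast
  have R'_near: "(g x, g y) \<in> near (resolved s') (2 * 2 ^ far_rank \<phi> + 2)"
    if xy: "x \<in> U" "y \<in> U" "{x, y} \<in> R'" for x y
  proof (cases "{x, y} \<in> R")
    case True
    then have "(g x, g y) \<in> near (resolved s) (2 * 2 ^ far_rank \<phi> + 2)"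
      using R xy unfolding well_resolved_def by blast
    then show ?thesis by (rule near_rel_mono[OF grow])
  next
    case False
    then obtain X Y where XY: "(X, Y) \<in> F" "{x, y} \<in> pairs_between X Y"
      using xy(3) unfolding R'_def by blast
    then obtain x0 y0 where w: "X \<in> classes s" "Y \<in> classes s" "x0 \<in> X" "y0 \<in> Y"
      "far_apart s x0 y0" "\<not> far_apart s' x0 y0"
      unfolding F_def by blast
    have new: "(g a, g b) \<in> near (resolved s') (2 * 2 ^ far_rank \<phi> + 2)" if "a \<in> X" "b \<in> Y" for a b
      by (rule newly_near[OF s step _ _ w(5,6)]) (use classes_eqv[OF s(1)] w(1-4) that in blast)+
    from XY(2) consider "x \<in> X" "y \<in> Y" | "y \<in> X" "x \<in> Y" unfolding pairs_between_pair by blast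
    then show ?thesis
    proof cases
      case 1
      then show ?thesis by (rule new)
    next
      case 2
      then show ?thesis using new S'.near_commute[of "g x" "g y"] by blast
    qed
  qed
  have R': "well_resolved s' R'"
    unfolding well_resolved_def
  proof (intro conjI ballI impI)
    show "R' \<subseteq> nsets U 2" using R unfolding well_resolved_def R'_def by blast
    fix x y assume xy: "x \<in> U" "y \<in> U" "x \<noteq> y" and near: "\<not> far_apart s' x y"
    show "{x, y} \<in> R'"
    proof (cases "{x, y} \<in> R")
      case False
      obtain X Y where XY: "X \<in> classes s" "x \<in> X" "Y \<in> classes s" "y \<in> Y"
        using partition_onD1[OF partition_classes[OF s(1)]] xy(1,2) by blast
      then have "(X, Y) \<in> F" unfolding F_def using False near unres_far[OF xy False] by blast
      moreover have "{x, y} \<in> pairs_between X Y" using XY unfolding pairs_between_pair by blast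
      ultimately show ?thesis using xy nsets_2_pair[of x y U] unfolding R'_def by blast
    qed (simp add: R'_def)
  qed (rule R'_near)
  \<comment> \<open>A step changes either the parts or the resolved relation, so one of the two widths applies.\<close>
  have few: "card {A \<in> parts s. \<exists>w\<in>A. (v, w) \<in> near (resolved s') (source_radius \<phi> r)} \<le> k" if v: "v \<in> V" for v
    using cons(1) step
  proof (cases rule: step_resolved_cases)
    case same
    then show ?thesis using narrow_near[OF narrow(1) cons(1) finite_V v] by simp
  next
    case (new A B)
    then show ?thesis using narrow_near[OF narrow(2) cons(2) finite_V v] by simp
  qed
  have nar: "narrow U r (target_width \<phi> k) (state s R')"
    by (rule narrow_classes[OF s(1) R'_near grow few])
  have "steps r k (state s R) (state s R')"
    unfolding R'_def
  proof (rule resolve_pairs[OF partition_classes[OF s(1)] finite_classes])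
    show F: "F \<subseteq> classes s \<times> classes s" by (auto simp: F_def)
    then show "finite F" using finite_classes finite_subset by blast
    show "narrow U r (target_width \<phi> k) (state s (R \<union> (\<Union>(X, Y)\<in>F. pairs_between X Y) \<inter> nsets U 2))"
      using nar unfolding R'_def .
    fix X Y assume "(X, Y) \<in> F"
    then have XY: "X \<in> classes s" "Y \<in> classes s" using F by auto
    have same: "e \<in> edges H \<longleftrightarrow> e' \<in> edges H"
      if e: "e \<in> pairs_between X Y \<inter> nsets U 2 - R" and e': "e' \<in> pairs_between X Y \<inter> nsets U 2 - R" for e e'
    proof -
      obtain x y where xy: "e = {x, y}" "x \<in> X" "y \<in> Y" using e unfolding pairs_between_def by blast
      obtain x' y' where xy': "e' = {x', y'}" "x' \<in> X" "y' \<in> Y" using e' unfolding pairs_between_def by blast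
      have "x \<in> U" "y \<in> U" "x \<noteq> y" "x' \<in> U" "y' \<in> U" "x' \<noteq> y'"
        using e e' nsets_2_pair[of x y U] nsets_2_pair[of x' y' U] unfolding xy(1) xy'(1) by auto
      then have "far_apart s x y" "far_apart s x' y'"
        using e e' unres_far unfolding xy(1) xy'(1) by blast+
      then show ?thesis
        unfolding xy(1) xy'(1)
        using far_apart_edges[OF s(1)] classes_eqv[OF s(1) XY(1) xy(2) xy'(2)]
          classes_eqv[OF s(1) XY(2) xy(3) xy'(3)] by blast
    qed
    then show "pairs_between X Y \<inter> nsets U 2 - R \<subseteq> edges H \<or>
        (pairs_between X Y \<inter> nsets U 2 - R) \<inter> edges H = {}"
      by blast
  qed
  moreover have "steps r k (state s R') (state s' R')"
    by (rule merge_parts[OF refines_classes[OF s eqv_step[OF s(1) step]] finite_classes nar])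
  ultimately show ?thesis using R' by (meson rtranclp_trans)
qed

lemma follow_steps:
  assumes "successively cstep (s # ss)" "\<And>t. t \<in> set (s # ss) \<Longrightarrow> valid t"
    and "\<And>t. t \<in> set (s # ss) \<Longrightarrow> narrow V (source_radius \<phi> r) k t" "well_resolved s R"
  shows "\<exists>R'. well_resolved (last (s # ss)) R' \<and> steps r k (state s R) (state (last (s # ss)) R')"
  using assms
proof (induction ss arbitrary: s R)
  case Nil
  then show ?case by auto
next
  case (Cons u ss)
  obtain R1 where R1: "well_resolved u R1" "steps r k (state s R) (state u R1)"
    using follow_step[of s u R r k] Cons.prems by auto
  obtain R2 where R2: "well_resolved (last (u # ss)) R2" "steps r k (state u R1) (state (last (u # ss)) R2)"
    using Cons.IH[OF _ _ _ R1(1)] Cons.prems(1-3) by auto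
  show ?case using R2 rtranclp_trans[OF R1(2) R2(2)] by auto
qed

text \<open>
  Initially all types differ because all labels do. In the end every pair of \<open>G\<close> is resolved, so no two
  vertices are far apart and all pairs of \<open>H\<close> are resolved; the remaining classes are merged into one part.
\<close>

theorem merge_width_transduced:
  assumes "merge_width (source_radius \<phi> r) G \<le> enat k"
  shows "merge_width r H \<le> enat (target_width \<phi> k)"
proof -
  obtain ss where ss: "construction_sequence_of G ss"
    "\<And>s. s \<in> set ss \<Longrightarrow> narrow V (source_radius \<phi> r) k s"
    using merge_width_leE[OF assms finite_V] by blast
  let ?s = "initial_state V"
  obtain ts where ts: "ss = ?s # ts" and succ: "successively cstep (?s # ts)"
    and fin: "unres (last (?s # ts)) = {}" "pos (last (?s # ts)) = edges G"
    using ss(1) unfolding construction_sequence_of_def construction_sequence_def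
    by (cases ss) auto
  let ?t = "last (?s # ts)"
  have valid: "valid t" if "t \<in> set (?s # ts)" for t
  proof -
    from that obtain us vs where split: "?s # ts = us @ t # vs" by (meson split_list)
    then have "successively cstep (t # vs)" "last (t # vs) = ?t"
      using succ by (simp_all add: successively_append_iff)
    moreover have "consistent V t" by (rule consistent_steps[OF succ consistent_initial that])
    ultimately show ?thesis
      using unresolved_decided_by_parts[of t vs V] fin unfolding valid_def by metis
  qed
  have lab_initial: "u = v" if "lab ?s u = lab ?s v" "u \<in> V" "v \<in> V" for u v
  proof -
    have "{u} \<in> parts_of ?s v" using that unfolding lab_def by (auto simp: parts_of_def initial_state_def)
    then show ?thesis by (auto simp: parts_of_def)
  qed
  have valid_s: "valid ?s" and valid_t: "valid ?t" by (simp_all add: valid)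
  have "resolved ?s = {}" by (simp add: resolved_def initial_state_def)
  moreover have "near ({} :: 'a rel) d = Id" for d :: nat
    unfolding near_def by (induction d) auto
  ultimately have near_s: "(a, b) \<in> near (resolved ?s) d \<longleftrightarrow> a = b" for a b d by simp
  have well: "well_resolved ?s {}"
    unfolding well_resolved_def far_apart_def near_s using g(1) by (auto dest: inj_onD)
  have eqv_s: "eqv ?s = Id_on U"
  proof -
    interpret labelled_structure V "resolved ?s" E "lab ?s" by (rule state_structure[OF valid_s])
    have "g x = g y" if "x \<in> U" "y \<in> U" "same_type ?s (type_rank \<phi>) {(g x, g y)}" for x y
      using partial_iso_simps(1)[OF glob_iso[OF that(3)], of "g x" "g y"] lab_initial g_V that(1,2) by simp
    then show ?thesis using g(1) glob_Id unfolding eqv_def by (auto dest: inj_onD)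
  qed
  have "classes ?s = (\<lambda>v. {v}) ` U" unfolding classes_def eqv_s by (auto simp: quotient_def)
  then have start: "state ?s {} = initial_state U"
    unfolding graph_state_def by (simp add: initial_state_def)
  have start_narrow: "narrow U r (target_width \<phi> k) (state ?s {})"
  proof (rule narrow_classes[OF valid_s _ subset_refl])
    show "card {A \<in> parts ?s. \<exists>w\<in>A. (v, w) \<in> near (resolved ?s) (source_radius \<phi> r)} \<le> k" if "v \<in> V" for v
      using narrow_near[OF _ consistent_initial finite_V that] ss(2) ts by simp
  qed simp
  obtain R where R: "well_resolved ?t R" "steps r k (state ?s {}) (state ?t R)"
    using follow_steps[OF succ valid _ well] ss(2) ts by blast
  have "R = nsets U 2"
  proof
    show "nsets U 2 \<subseteq> R"
    proof
      fix e assume "e \<in> nsets U 2"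
      then obtain x y where e: "e = {x, y}" "x \<in> U" "y \<in> U" "x \<noteq> y"
        by (auto simp: nsets_def card_2_iff)
      have "g x \<noteq> g y" using e g(1) by (auto dest: inj_onD)
      then have "(g x, g y) \<in> resolved ?t"
        using resolved_or_unres[of ?t "g x" "g y"] valid_t e g_V fin(1) by (auto simp: valid_def)
      then have "(g x, g y) \<in> near (resolved ?t) (Suc 0)" by simp
      then have "(g x, g y) \<in> near (resolved ?t) (2 ^ far_rank \<phi>)" by (rule near_mono) simp
      then show "e \<in> R" using R(1) e unfolding well_resolved_def far_apart_def by blast
    qed
  qed (use R(1) in \<open>simp add: well_resolved_def\<close>)
  have narrow_t: "narrow U r (target_width \<phi> k) (state ?t R)"
    using R(2) start_narrow by (cases rule: rtranclp.cases) (auto simp: narrow_step_def)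
  define Q where "Q = U // (U \<times> U)"
  have univ: "equiv U (U \<times> U)" by (rule equivI) (auto simp: refl_on_def sym_def trans_def)
  have "refines U (classes ?t) Q"
    unfolding refines_def
  proof (intro conjI ballI)
    show "partition_on U Q" unfolding Q_def by (rule partition_on_quotient[OF univ])
    fix X assume X: "X \<in> classes ?t"
    then have "X \<subseteq> U" "X \<noteq> {}"
      using partition_onD1[OF partition_classes[OF valid_t]] partition_onD3[OF partition_classes[OF valid_t]] by auto
    then show "\<exists>Y\<in>Q. X \<subseteq> Y" unfolding Q_def by (fastforce simp: quotient_def)
  qed (rule partition_classes[OF valid_t])
  from merge_parts[OF this finite_classes narrow_t]
  have "steps r k (state ?s {}) (graph_state U (edges H) Q R)" using R(2) by (meson rtranclp_trans)
  from narrow_steps_list[OF this start_narrow]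
  obtain us where us: "us \<noteq> []" "hd us = initial_state U" "last us = graph_state U (edges H) Q R"
    "successively cstep us" "\<And>u. u \<in> set us \<Longrightarrow> narrow U r (target_width \<phi> k) u"
    unfolding start by blast
  have "Q \<subseteq> {U}" unfolding Q_def quotient_def by auto
  then have "card Q \<le> 1" using card_mono[of "{U}" Q] by simp
  moreover have "nsets U 2 \<inter> edges H = edges H" using H unfolding finite_simple_graph_def by blast
  ultimately have "construction_sequence_of H us"
    unfolding construction_sequence_of_def construction_sequence_def using us(1-4) \<open>R = nsets U 2\<close>
    by (simp add: graph_state_def)
  then show ?thesis using us(5) by (rule merge_width_leI)
qed

end

theorem corollary1p13:
  fixes \<C> :: "'a ugraph set" and \<D> :: "'b ugraph set"
  assumes "graph_class \<C>" and "graph_class \<D>"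
    and "transduces \<C> \<D>"
    and "bounded_merge_width \<C>"
  shows "bounded_merge_width \<D>"
  unfolding bounded_merge_width_iff
proof
  fix r
  obtain \<phi> where trans: "free_vars \<phi> \<subseteq> {0, 1} \<and>
      (\<forall>H\<in>\<D>. \<exists>G\<in>\<C>. \<exists>P W. (\<forall>i. P i \<subseteq> verts G) \<and> W \<subseteq> verts G \<and>
        isomorphic (transduced_graph \<phi> G P W) H)"
    using assms(3) unfolding transduces_def by (rule exE)
  obtain k where k: "\<And>G. G \<in> \<C> \<Longrightarrow> merge_width (source_radius \<phi> r) G \<le> enat k"
    using assms(4) unfolding bounded_merge_width_iff by blast
  have "merge_width r H \<le> enat (target_width \<phi> k)" if H: "H \<in> \<D>" for H
  proof -
    obtain G P W f where G: "G \<in> \<C>" "W \<subseteq> verts G" and bij: "bij_betw f W (verts H)"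
      and edges: "edges H = (\<lambda>e. f ` e) ` edges (transduced_graph \<phi> G P W)"
      using bspec[OF conjunct2[OF trans] H] unfolding isomorphic_def by (auto simp: transduced_graph_def)
    let ?g = "inv_into W f"
    note mw = k[OF G(1)]
    have inv: "?g x \<in> W" "f (?g x) = x" if "x \<in> verts H" for x
      using bij that by (auto simp: bij_betw_def inv_into_into f_inv_into_f)
    have inj_f: "inj_on f W" using bij by (simp add: bij_betw_def)
    interpret transduction G P \<phi> H ?g
    proof
      show "finite_simple_graph G" "finite_simple_graph H"
        using assms(1,2) G(1) H by (auto simp: graph_class_def)
      show "inj_on ?g (verts H)" using inv(2) by (metis inj_onI)
      show "?g ` verts H \<subseteq> verts G" using inv(1) G(2) by blast
      show "free_vars \<phi> \<subseteq> {0, 1}" by (rule conjunct1[OF trans])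
      fix x y assume xy: "x \<in> verts H" "y \<in> verts H" "x \<noteq> y"
      let ?e = "\<lambda>u v. sat2 G P \<phi> u v \<or> sat2 G P \<phi> v u"
      have "edges H = {{f u, f v} | u v. u \<in> W \<and> v \<in> W \<and> u \<noteq> v \<and> ?e u v}"
      proof (intro set_eqI iffI)
        fix e assume "e \<in> edges H"
        then obtain u v where uv: "u \<in> W" "v \<in> W" "u \<noteq> v" "?e u v" "e = f ` {u, v}"
          unfolding edges transduced_graph_def by auto
        then have "e = {f u, f v}" by simp
        with uv(1-4) show "e \<in> {{f u, f v} | u v. u \<in> W \<and> v \<in> W \<and> u \<noteq> v \<and> ?e u v}" by blast
      next
        fix e assume "e \<in> {{f u, f v} | u v. u \<in> W \<and> v \<in> W \<and> u \<noteq> v \<and> ?e u v}"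
        then obtain u v where uv: "u \<in> W" "v \<in> W" "u \<noteq> v" "?e u v" "e = {f u, f v}" by blast
        then have "{u, v} \<in> edges (transduced_graph \<phi> G P W)"
          unfolding transduced_graph_def by auto
        moreover have "e = f ` {u, v}" using uv(5) by simp
        ultimately show "e \<in> edges H" unfolding edges by (rule rev_image_eqI)
      qed
      then have "{x, y} \<in> edges H \<longleftrightarrow> (\<exists>u v. {x, y} = {f u, f v} \<and> u \<in> W \<and> v \<in> W \<and> u \<noteq> v \<and> ?e u v)"
        by (simp only: mem_Collect_eq)
      also have "\<dots> \<longleftrightarrow> ?e (?g x) (?g y)"
      proof
        assume "\<exists>u v. {x, y} = {f u, f v} \<and> u \<in> W \<and> v \<in> W \<and> u \<noteq> v \<and> ?e u v"
        then obtain u v where uv: "{x, y} = {f u, f v}" "u \<in> W" "v \<in> W" "?e u v" by blast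
        then have "?g (f u) = u" "?g (f v) = v" using inj_f by simp_all
        then show "?e (?g x) (?g y)" using uv(1,4) by (auto simp: doubleton_eq_iff)
      next
        assume "?e (?g x) (?g y)"
        moreover have "?g x \<noteq> ?g y" using inv(2)[OF xy(1)] inv(2)[OF xy(2)] xy(3) by metis
        ultimately show "\<exists>u v. {x, y} = {f u, f v} \<and> u \<in> W \<and> v \<in> W \<and> u \<noteq> v \<and> ?e u v"
          using inv[OF xy(1)] inv[OF xy(2)] by metis
      qed
      finally show "{x, y} \<in> edges H \<longleftrightarrow> ?e (?g x) (?g y)" .
    qed
    show ?thesis by (rule merge_width_transduced[OF mw])
  qed
  then show "\<exists>k. \<forall>H\<in>\<D>. merge_width r H \<le> enat k" by blast
qed

end
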